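(* For every prime $p$ and every integer $d\ge0$, the power series $\mathcal{A}_d(t),\mathcal{B}_d(t),\mathcal{R}_d(t)$ are polynomials in $t$ of degree at most $2d$. Moreover $\alpha(n,d)=\mathcal{A}_d(1)$ and $\beta(n,d)=\mathcal{B}_d(1)$ for all $n\ge 2d$, and $\rho(n,d)=\mathcal{R}_d(1)$ for all $n\ge 2d-1$. In particular $\alpha(n,d),\beta(n,d),\rho(n,d)$ are independent of $n$ for $n\ge 2d$ (resp. $n\ge2d$, $n\ge 2d-1$).
   Context: Fix a prime $p$ and let $\mathbb{Z}_p,\mathbb{Q}_p$ be the $p$-adic integers and numbers. Random polynomials: (i) a random polynomial of degree $n$ over $\mathbb{Z}_p$ is $f=c_nx^n+\dots+c_0$ with $(c_0,\dots,c_n)\in\mathbb{Z}_p^{n+1}$ distributed according to the Haar measure normalized to total mass $1$; (ii) a random monic polynomial of degree $n$ is $f=x^n+a_{n-1}x^{n-1}+\dots+a_0$ with $(a_0,\dots,a_{n-1})\in\mathbb{Z}_p^n$ Haar-distributed with total mass $1$; (iii) a random monic polynomial of degree $n$ reducing to $x^n$ mod $p$ is $f=x^n+a_{n-1}x^{n-1}+\dots+a_0$ with $(a_0,\dots,a_{n-1})$ Haar-distributed on $(p\mathbb{Z}_p)^n$ normalized to total mass $1$. For $f\neq0$ let $X(f)$ be the number of distinct roots of $f$ in $\mathbb{Q}_p$. Define $\rho(n,d)=\mathbb{E}\binom{X}{d}$ for model (i), $\alpha(n,d)=\mathbb{E}\binom{X}{d}$ for model (ii), $\beta(n,d)=\mathbb{E}\binom{X}{d}$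 for model (iii), for all integers $n,d\ge0$. Generating functions: $\mathcal{A}_d(t)=(1-t)\sum_{n\ge0}\alpha(n,d)t^n$, $\mathcal{B}_d(t)=(1-t)\sum_{n\ge0}\beta(n,d)t^n$, $\mathcal{R}_d(t)=(1-t)(1-pt)\sum_{n\ge0}(p^n+p^{n-1}+\dots+1)\rho(n,d)t^n$. *)

theory Defs
  imports "HOL-Probability.Probability" "HOL-Computational_Algebra.Computational_Algebra"
begin

text \<open>p-adic integers are represented by their digit sequences a :: nat => nat
  (digits a i < p), i.e. the element sum_i a i * p^i of Z_p.  The residue of such an
  element modulo p^k is zp_res p k a.\<close>

definition zp_res :: "nat \<Rightarrow> nat \<Rightarrow> (nat \<Rightarrow> nat) \<Rightarrow> int" where
  "zp_res p k a = (\<Sum>i<k. int (a i) * int p ^ i)"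

definition zp_digits :: "nat \<Rightarrow> (nat \<Rightarrow> nat) \<Rightarrow> bool" where
  "zp_digits p a \<longleftrightarrow> (\<forall>i. a i < p)"

definition zp_one :: "nat \<Rightarrow> nat" where
  "zp_one j = (if j = 0 then 1 else 0)"

text \<open>Every element of Q_p = Frac(Z_p) is u / p^m with m :: nat and u in Z_p.
  The pair (m,u) represents u / p^m; two pairs represent the same element iff
  u * p^m' = u' * p^m in Z_p, i.e. iff this holds modulo p^k for all k.\<close>
definition qp_eq :: "nat \<Rightarrow> nat \<times> (nat \<Rightarrow> nat) \<Rightarrow> nat \<times> (nat \<Rightarrow> nat) \<Rightarrow> bool" where
  "qp_eq p x y \<longleftrightarrow> (\<forall>k. (zp_res p k (snd x) * int p ^ fst y - zp_res p k (snd y) * int p ^ fst x)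
                              mod (int p ^ k) = 0)"

text \<open>For the polynomial f = sum_{i<=n} c_i x^i with coefficients c_i in Z_p,
  u / p^m is a root iff p^(m n) f(u/p^m) = sum_i c_i u^i p^(m(n-i)) = 0 in Z_p.\<close>
definition qp_is_root :: "nat \<Rightarrow> nat \<Rightarrow> (nat \<Rightarrow> nat \<Rightarrow> nat) \<Rightarrow> nat \<times> (nat \<Rightarrow> nat) \<Rightarrow> bool" where
  "qp_is_root p n c x \<longleftrightarrow>
     (\<forall>k. (\<Sum>i\<le>n. zp_res p k (c i) * zp_res p k (snd x) ^ i * int p ^ (fst x * (n - i)))
            mod (int p ^ k) = 0)"

definition num_roots :: "nat \<Rightarrow> nat \<Rightarrow> (nat \<Rightarrow> nat \<Rightarrow> nat) \<Rightarrow> nat" where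
  "num_roots p n c =
     card ((\<lambda>x. {y. zp_digits p (snd y) \<and> qp_eq p x y}) `
           {x. zp_digits p (snd x) \<and> qp_is_root p n c x})"

text \<open>Haar probability measure on Z_p^I: independent uniform digits, indexed by
  (coordinate, digit position).\<close>
definition zp_haar :: "nat \<Rightarrow> 'i set \<Rightarrow> ('i \<times> nat \<Rightarrow> nat) measure" where
  "zp_haar p I = PiM (I \<times> UNIV) (\<lambda>_. measure_pmf (pmf_of_set {..<p}))"

definition rho :: "nat \<Rightarrow> nat \<Rightarrow> nat \<Rightarrow> real" where
  "rho p n d = (\<integral>\<omega>. real (num_roots p n (\<lambda>i j. \<omega> (i, j)) choose d) \<partial>zp_haar p {..n})"

definition alpha :: "nat \<Rightarrow> nat \<Rightarrow> nat \<Rightarrow> real" where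
  "alpha p n d = (\<integral>\<omega>. real (num_roots p n
       (\<lambda>i j. if i = n then zp_one j else \<omega> (i, j)) choose d) \<partial>zp_haar p {..<n})"

text \<open>Model (iii): monic, (a_0..a_(n-1)) normalized Haar on (pZ_p)^n; an element of pZ_p
  is p*b with b Haar on Z_p, i.e. digit 0 equals 0 and the other digits are uniform.\<close>
definition beta :: "nat \<Rightarrow> nat \<Rightarrow> nat \<Rightarrow> real" where
  "beta p n d = (\<integral>\<omega>. real (num_roots p n
       (\<lambda>i j. if i = n then zp_one j else if j = 0 then 0 else \<omega> (i, j)) choose d) \<partial>zp_haar p {..<n})"

end

theory Submission
  imports Defs "HOL-Number_Theory.Cong"
begin

text \<open>Everything reduces to showing that the expectations do not depend on n once n is at least
  2d (or 2d - 1 for the first model).  By Hensel's lemma, a simple root of f corresponds, for large k,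
  to a residue class a modulo p^k such that m = v(f'(a)) < k and v(f(a)) is at least k + m.  So the
  expected number of d-sets of roots is the limit over k of sums, over sets S of d residue classes, of
  the probability that all members of S satisfy this condition, which only involves the values of f
  and f' on S modulo p^(2k).  These values determine f modulo the square of the polynomial
  g vanishing on S.  As g^2 has degree 2d, division with remainder shows that the vector of values is
  uniformly distributed on a group which does not depend on n, so that each of these probabilities is
  already exactly independent of n.\<close>

section \<open>p-adic integers and Hensel's lemma\<close>

text \<open>The group meant above consists of the jets (value and derivative) of all integer
  polynomials, not of all pairs of residues: points of S may be p-adically close, which ties their
  jets together. What has to be shown is that degree n already reaches the whole group. The obstacle
  is roots with denominators, since p^(m n) f(u / p^m) involves n. They are moved to the point p^m /
  u of the chart at infinity, where f is replaced by its reversal. Such points are divisible by p,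
  so modulo p they only constrain the top coefficients, and n + 1 free coefficients can meet the
  conditions in both charts at once; hence 2d - 1 in the first model. Monic polynomials have n free
  coefficients, hence 2d. Their roots are integral, and divisible by p in the third model; then x^n
  has the same jet as some multiple of p. The precision p^(2k) makes the quadratic Taylor term
  vanish for points that agree modulo p^k. It also beats the number of classes: there are at most k
  p^k of them, while f vanishes modulo p^(2k) at a given one with probability at most p^(1 -
  2k).\<close>

lemma zp_res_0 [simp]: "zp_res p 0 a = 0"
  by (simp add: zp_res_def)

lemma zp_res_Suc: "zp_res p (Suc k) a = zp_res p k a + int (a k) * int p ^ k"
  by (simp add: zp_res_def)

lemma zp_res_Suc_shift: "zp_res p (Suc k) a = int (a 0) + int p * zp_res p k (\<lambda>j. a (Suc j))"
  unfolding zp_res_def sum.lessThan_Suc_shift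
  by (simp add: sum_distrib_left mult_ac)

lemma zp_res_cong:
  assumes "j \<le> k"
  shows "int p ^ j dvd zp_res p k a - zp_res p j a"
  using assms
proof (induction k rule: dec_induct)
  case (step k)
  have "int p ^ j dvd int (a k) * int p ^ k"
    using step.hyps by (simp add: dvd_mult le_imp_power_dvd)
  from dvd_add[OF step.IH this] show ?case
    by (simp add: zp_res_Suc algebra_simps)
qed simp

lemma zp_res_range:
  assumes "zp_digits p a"
  shows "0 \<le> zp_res p k a" "zp_res p k a < int p ^ k"
proof -
  show "zp_res p k a < int p ^ k"
  proof (induction k)
    case (Suc k)
    have "int (a k) + 1 \<le> int p"
      using assms by (metis zp_digits_def Suc_le_eq of_nat_Suc of_nat_le_iff add.commute)
    then have "(int (a k) + 1) * int p ^ k \<le> int p * int p ^ k"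
      by (intro mult_right_mono) auto
    then show ?case using Suc by (simp add: zp_res_Suc algebra_simps)
  qed simp
qed (simp add: zp_res_def sum_nonneg)

lemma zp_digits_eqI:
  assumes "zp_digits p a" "zp_digits p b" "\<And>k. int p ^ k dvd zp_res p k a - zp_res p k b"
  shows "a = b"
proof
  fix i
  have p: "p > 0" using assms(1) by (metis gr_zeroI not_less_zero zp_digits_def)
  have eq: "zp_res p k a = zp_res p k b" for k
  proof -
    have "\<bar>zp_res p k a - zp_res p k b\<bar> < int p ^ k"
      using zp_res_range[OF assms(1), of k] zp_res_range[OF assms(2), of k] by linarith
    then show ?thesis using assms(3)[of k] zdvd_not_zless
      by (metis abs_ge_zero dvd_abs_iff abs_0_eq eq_iff_diff_eq_0 less_le)
  qed
  show "a i = b i" using eq[of i] eq[of "Suc i"] p by (simp add: zp_res_Suc)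
qed

lemma zp_complete:
  fixes r :: "nat \<Rightarrow> int"
  assumes p: "p > 0" and r: "\<And>i. int p ^ i dvd r (Suc i) - r i"
  obtains u where "zp_digits p u" "\<And>i. int p ^ i dvd zp_res p i u - r i"
proof
  \<comment> \<open>Digit i is read from \<open>r (Suc i)\<close>, the first term that already
    agrees with the limit modulo p^(i + 1).\<close>
  define u where "u i = nat (r (Suc i) div int p ^ i mod int p)" for i
  show "zp_digits p u" using p by (auto simp: zp_digits_def u_def nat_less_iff)
  show "int p ^ i dvd zp_res p i u - r i" for i
  proof (induction i)
    case (Suc i)
    define q where "q = r (Suc i) div int p ^ i"
    have ui: "int (u i) = q mod int p" using p by (simp add: u_def q_def)
    have "int p ^ i dvd zp_res p i u - r (Suc i)"
      using dvd_diff[OF Suc r[of i]] by (simp add: algebra_simps)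
    then have "zp_res p i u mod int p ^ i = r (Suc i) mod int p ^ i"
      by (simp add: mod_eq_dvd_iff)
    moreover have "zp_res p i u mod int p ^ i = zp_res p i u"
      using zp_res_range[OF \<open>zp_digits p u\<close>] by simp
    ultimately have "r (Suc i) = q * int p ^ i + zp_res p i u"
      unfolding q_def by (metis div_mult_mod_eq)
    then have "zp_res p (Suc i) u - r (Suc i) = - (int p ^ i * (q - q mod int p))"
      unfolding zp_res_Suc ui by (simp add: algebra_simps)
    also have "\<dots> = - (int p ^ Suc i * (q div int p))"
      by (simp add: minus_mod_eq_mult_div)
    finally show ?case by simp
  qed simp
qed

section \<open>Taylor expansion and Hensel lifting for integer polynomials\<close>

lemma poly_taylor2:
  fixes f :: "'a::idom poly"
  obtains q where "poly f (a + h) = poly f a + h * poly (pderiv f) a + h\<^sup>2 * q"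
proof -
  have "\<exists>q. poly f (a + h) = poly f a + h * poly (pderiv f) a + h\<^sup>2 * q"
  proof (induction f)
    case (pCons c f)
    then obtain q where q: "poly f (a + h) = poly f a + h * poly (pderiv f) a + h\<^sup>2 * q" by auto
    show ?case
      by (intro exI[of _ "poly (pderiv f) a + (a + h) * q"])
        (simp add: q pderiv_pCons algebra_simps power2_eq_square)
  qed simp
  then show thesis using that by blast
qed

lemma poly_diff_dvd:
  fixes f :: "'a::idom poly"
  assumes "d dvd a - b"
  shows "d dvd poly f a - poly f b"
proof -
  obtain h where h: "a = b + d * h" using assms by (metis dvdE diff_add_cancel add.commute)
  obtain q where "poly f (b + d * h) = poly f b + d * h * poly (pderiv f) b + (d * h)\<^sup>2 * q"
    by (rule poly_taylor2)
  then show ?thesis unfolding h by (simp add: power2_eq_square mult.assoc)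
qed

text \<open>Separated from polynomials because at infinity the second entry will be b g'(b) instead
  of a derivative. Exact divisibility by p^\<mu> excludes y = 0.\<close>

definition hensel_pair :: "nat \<Rightarrow> nat \<Rightarrow> int \<Rightarrow> int \<Rightarrow> bool" where
  "hensel_pair p k x y \<longleftrightarrow>
     (\<exists>\<mu><k. int p ^ \<mu> dvd y \<and> \<not> int p ^ Suc \<mu> dvd y \<and> int p ^ (k + \<mu>) dvd x)"

text \<open>By Hensel's lemma, such a class modulo p^k contains exactly one root r of f, and the valuation
  of f'(r) is less than k.\<close>

definition hensel_class :: "nat \<Rightarrow> nat \<Rightarrow> int poly \<Rightarrow> int \<Rightarrow> bool" where
  "hensel_class p k f a \<longleftrightarrow> hensel_pair p k (poly f a) (poly (pderiv f) a)"

text \<open>As \<mu> < k, the condition inspects y only up to p^(\<mu> + 1), a divisor of p^k, and x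
  only up to p^(k + \<mu>), a divisor of p^(2k).\<close>

lemma hensel_pair_cong_imp:
  assumes "int p ^ (2 * k) dvd x - x'" "int p ^ k dvd y - y'" "hensel_pair p k x y"
  shows "hensel_pair p k x' y'"
proof -
  obtain \<mu> where \<mu>: "\<mu> < k" "int p ^ \<mu> dvd y" "\<not> int p ^ Suc \<mu> dvd y" "int p ^ (k + \<mu>) dvd x"
    using assms(3) by (auto simp: hensel_pair_def)
  have "int p ^ \<mu> dvd y - y'" "int p ^ Suc \<mu> dvd y - y'" "int p ^ (k + \<mu>) dvd x - x'"
    using \<mu>(1) assms(1,2) by (meson dvd_trans le_imp_power_dvd Suc_leI less_imp_le,
        meson dvd_trans le_imp_power_dvd Suc_leI,
        metis dvd_trans le_imp_power_dvd add_left_mono less_imp_le mult_2)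
  then have "int p ^ \<mu> dvd y'" "\<not> int p ^ Suc \<mu> dvd y'" "int p ^ (k + \<mu>) dvd x'"
    using \<mu> by (metis dvd_diff_commute dvd_diff_right_iff dvd_diff_left_iff)+
  then show ?thesis using \<mu>(1) unfolding hensel_pair_def by blast
qed

lemma hensel_pair_cong:
  assumes "int p ^ (2 * k) dvd x - x'" "int p ^ k dvd y - y'"
  shows "hensel_pair p k x y \<longleftrightarrow> hensel_pair p k x' y'"
  using hensel_pair_cong_imp[OF assms] hensel_pair_cong_imp[of p k x' x y' y] assms
  by (auto simp: dvd_diff_commute)

text \<open>One Newton step. With f(a) = p^(k + \<mu>) x and f'(a) = p^\<mu> y, the number y is
  prime to p and t solves x + t y = 0 modulo p. The quadratic error is a multiple of p^(2k), hence
  of p^(k + \<mu> + 1); f' changes by a multiple of p^k, so its valuation \<mu> persists.\<close>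

lemma hensel_step:
  assumes p: "prime p" and "hensel_class p k f a"
  obtains t where "hensel_class p (Suc k) f (a + int p ^ k * t)"
proof -
  obtain \<mu> where \<mu>: "\<mu> < k" "int p ^ \<mu> dvd poly (pderiv f) a"
      "\<not> int p ^ Suc \<mu> dvd poly (pderiv f) a" "int p ^ (k + \<mu>) dvd poly f a"
    using assms(2) by (auto simp: hensel_class_def hensel_pair_def)
  obtain y where y: "poly (pderiv f) a = int p ^ \<mu> * y" using \<mu>(2) by blast
  obtain x where x: "poly f a = int p ^ (k + \<mu>) * x" using \<mu>(4) by blast
  have "\<not> int p dvd y" using \<mu>(3) y by (auto simp: mult.commute)
  then have "coprime y (int p)"
    using p by (metis coprime_commute prime_imp_coprime prime_nat_int_transfer)
  then obtain z where z: "[y * z = 1] (mod int p)"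
    using cong_solve_coprime_int by blast
  define t where "t = - (x * z)"
  obtain q where q: "poly f (a + int p ^ k * t) =
      poly f a + int p ^ k * t * poly (pderiv f) a + (int p ^ k * t)\<^sup>2 * q"
    by (rule poly_taylor2)
  have "int p dvd y * z - 1" using z by (simp add: cong_iff_dvd_diff)
  moreover have "x + t * y = - (x * (y * z - 1))" by (simp add: t_def algebra_simps)
  ultimately have "int p dvd x + t * y" by simp
  then have "int p ^ (k + \<mu>) * int p dvd int p ^ (k + \<mu>) * (x + t * y)"
    by (rule mult_dvd_mono[OF dvd_refl])
  then have "int p ^ (Suc k + \<mu>) dvd poly f a + int p ^ k * t * poly (pderiv f) a"
    unfolding x y by (simp add: power_add algebra_simps)
  moreover have "int p ^ (Suc k + \<mu>) dvd int p ^ (k * 2)"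
    by (rule le_imp_power_dvd) (use \<mu>(1) in simp)
  then have "int p ^ (Suc k + \<mu>) dvd (int p ^ k * t)\<^sup>2 * q"
    by (simp add: power_mult_distrib dvd_mult2 flip: power_mult)
  ultimately have 1: "int p ^ (Suc k + \<mu>) dvd poly f (a + int p ^ k * t)"
    unfolding q by (rule dvd_add)
  have d: "int p ^ k dvd poly (pderiv f) (a + int p ^ k * t) - poly (pderiv f) a"
    by (rule poly_diff_dvd) simp
  then have d1: "int p ^ \<mu> dvd poly (pderiv f) (a + int p ^ k * t) - poly (pderiv f) a"
      and d2: "int p ^ Suc \<mu> dvd poly (pderiv f) (a + int p ^ k * t) - poly (pderiv f) a"
    using \<mu>(1) by (meson dvd_trans le_imp_power_dvd less_imp_le Suc_leI)+
  have "int p ^ \<mu> dvd poly (pderiv f) (a + int p ^ k * t)"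
      "\<not> int p ^ Suc \<mu> dvd poly (pderiv f) (a + int p ^ k * t)"
    using dvd_diff_right_iff d1 d2 \<mu>(2,3) by (metis dvd_diff_left_iff)+
  then have "hensel_class p (Suc k) f (a + int p ^ k * t)"
    using 1 \<mu>(1) unfolding hensel_class_def hensel_pair_def
    by (intro exI[of _ \<mu>]) auto
  then show thesis by (rule that)
qed

lemma hensel_approx:
  assumes p: "prime p" and "hensel_class p k f a" and "k \<le> K"
  obtains b where "int p ^ k dvd b - a" "hensel_class p K f b"
proof -
  have "\<exists>b. int p ^ k dvd b - a \<and> hensel_class p K f b"
    using assms(3)
  proof (induction K rule: dec_induct)
    case base
    show ?case using assms(2) by (intro exI[of _ a]) auto
  next
    case (step K)
    then obtain b where b: "int p ^ k dvd b - a" "hensel_class p K f b" by blast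
    obtain t where t: "hensel_class p (Suc K) f (b + int p ^ K * t)"
      using hensel_step[OF p b(2)] .
    have "int p ^ k dvd (b - a) + int p ^ K * t"
      using b(1) step.hyps by (intro dvd_add) (auto intro: dvd_mult2 le_imp_power_dvd)
    then show ?case using t by (intro exI[of _ "b + int p ^ K * t"]) (simp add: algebra_simps)
  qed
  then show thesis using that by blast
qed

section \<open>Roots with a fixed denominator, for p-adic coefficients\<close>

lemma pderiv_sum:
  fixes f :: "'b \<Rightarrow> 'a::idom poly"
  shows "pderiv (sum f A) = (\<Sum>x\<in>A. pderiv (f x))"
  by (induction A rule: infinite_finite_induct) (simp_all add: pderiv_add)

text \<open>For f with coefficients w this is p^(m n) f(x / p^m); its roots are the numerators u of
  the roots u / p^m of f.\<close>

definition scaled_poly :: "nat \<Rightarrow> nat \<Rightarrow> nat \<Rightarrow> (nat \<Rightarrow> int) \<Rightarrow> int poly" where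
  "scaled_poly p n m w = (\<Sum>i\<le>n. monom (w i * int p ^ (m * (n - i))) i)"

definition zp_poly :: "nat \<Rightarrow> nat \<Rightarrow> (nat \<Rightarrow> nat \<Rightarrow> nat) \<Rightarrow> nat \<Rightarrow> nat \<Rightarrow> int poly" where
  "zp_poly p n c m k = scaled_poly p n m (\<lambda>i. zp_res p k (c i))"

lemma poly_scaled_poly: "poly (scaled_poly p n m w) a = (\<Sum>i\<le>n. w i * int p ^ (m * (n - i)) * a ^ i)"
  by (simp add: scaled_poly_def poly_sum poly_monom)

lemma poly_pderiv_scaled_poly:
  "poly (pderiv (scaled_poly p n m w)) a =
     (\<Sum>i\<le>n. of_nat i * (w i * int p ^ (m * (n - i))) * a ^ (i - 1))"
  by (simp add: scaled_poly_def pderiv_sum poly_sum poly_monom pderiv_monom)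

lemma zp_poly_cong:
  assumes "j \<le> k"
  shows "int p ^ j dvd poly (zp_poly p n c m k) a - poly (zp_poly p n c m j) a"
    "int p ^ j dvd poly (pderiv (zp_poly p n c m k)) a - poly (pderiv (zp_poly p n c m j)) a"
proof -
  have d: "int p ^ j dvd zp_res p k (c i) - zp_res p j (c i)" for i
    using assms by (rule zp_res_cong)
  have "int p ^ j dvd (\<Sum>i\<le>n. (zp_res p k (c i) - zp_res p j (c i)) * (int p ^ (m * (n - i)) * a ^ i))"
    using d by (intro dvd_sum) (simp add: dvd_mult2)
  then show "int p ^ j dvd poly (zp_poly p n c m k) a - poly (zp_poly p n c m j) a"
    by (simp add: zp_poly_def poly_scaled_poly algebra_simps sum_subtractf)
  have "int p ^ j dvd (\<Sum>i\<le>n. (zp_res p k (c i) - zp_res p j (c i)) *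
      (of_nat i * int p ^ (m * (n - i)) * a ^ (i - 1)))"
    using d by (intro dvd_sum) (simp add: dvd_mult2)
  then show "int p ^ j dvd poly (pderiv (zp_poly p n c m k)) a - poly (pderiv (zp_poly p n c m j)) a"
    by (simp add: zp_poly_def poly_pderiv_scaled_poly algebra_simps sum_subtractf)
qed

lemma hensel_class_zp_poly_cong:
  assumes "2 * k \<le> K"
  shows "hensel_class p k (zp_poly p n c m K) a \<longleftrightarrow> hensel_class p k (zp_poly p n c m (2 * k)) a"
  unfolding hensel_class_def
proof (rule hensel_pair_cong)
  show "int p ^ (2 * k) dvd poly (zp_poly p n c m K) a - poly (zp_poly p n c m (2 * k)) a"
    by (rule zp_poly_cong(1)[OF assms])
  show "int p ^ k dvd poly (pderiv (zp_poly p n c m K)) a - poly (pderiv (zp_poly p n c m (2 * k))) a"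
    using zp_poly_cong(2)[OF assms] by (rule dvd_trans[rotated]) (simp add: le_imp_power_dvd)
qed

lemma qp_is_root_iff:
  "qp_is_root p n c (m, u) \<longleftrightarrow> (\<forall>k. int p ^ k dvd poly (zp_poly p n c m k) (zp_res p k u))"
  by (simp add: qp_is_root_def zp_poly_def poly_scaled_poly dvd_eq_mod_eq_0 mult_ac)

text \<open>Compactness of Z_p in the form of Koenig's lemma: if a class contains approximate zeros
  of every precision, so does one of its p subclasses. It serves both for existence in Hensel's
  lemma and, later, for turning "this class contains a root" into a countable conjunction of finite
  conditions.\<close>

lemma zp_root_compactness:
  assumes p: "p > 0"
    and approx: "\<And>K. \<exists>b. int p ^ k dvd b - a \<and> int p ^ K dvd poly (zp_poly p n c m K) b"
  obtains u where "zp_digits p u" "int p ^ k dvd zp_res p k u - a" "qp_is_root p n c (m, u)"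
proof -
  define B where "B j s \<longleftrightarrow> (\<forall>K. \<exists>b. int p ^ j dvd b - s \<and> int p ^ K dvd poly (zp_poly p n c m K) b)"
    for j s
  have step: "\<exists>s'. B (Suc j) s' \<and> int p ^ j dvd s' - s" if B: "B j s" for j s
  proof (rule ccontr)
    assume no: "\<nexists>s'. B (Suc j) s' \<and> int p ^ j dvd s' - s"
    have "\<not> B (Suc j) (s + int p ^ j * int t)" for t
      using no by (auto dest!: spec[of _ "s + int p ^ j * int t"])
    then obtain K where K: "\<And>t b. int p ^ Suc j dvd b - (s + int p ^ j * int t) \<Longrightarrow>
        \<not> int p ^ K t dvd poly (zp_poly p n c m (K t)) b"
      unfolding B_def by metis
    \<comment> \<open>If every subclass t failed at some precision \<open>K t\<close>, all p of them
      would fail at the maximum M, although one of them contains the approximate zero b of precision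
      M.\<close>
    define M where "M = Max (K ` {..<p})"
    obtain b where b: "int p ^ j dvd b - s" "int p ^ M dvd poly (zp_poly p n c m M) b"
      using B unfolding B_def by blast
    obtain h where h: "b - s = int p ^ j * h" using b(1) by blast
    define t where "t = nat (h mod int p)"
    have t: "int t = h mod int p" "t < p" using p by (auto simp: t_def nat_less_iff)
    have "b - (s + int p ^ j * int t) = int p ^ j * (h - h mod int p)"
      using h by (simp add: t algebra_simps)
    also have "\<dots> = int p ^ Suc j * (h div int p)"
      by (simp add: minus_mod_eq_mult_div)
    finally have n: "\<not> int p ^ K t dvd poly (zp_poly p n c m (K t)) b"
      using K[of b t] by simp
    have le: "K t \<le> M" unfolding M_def using t by (intro Max_ge) auto
    have "int p ^ K t dvd poly (zp_poly p n c m M) b"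
      using b(2) le by (meson dvd_trans le_imp_power_dvd)
    with zp_poly_cong(1)[OF le, of p n c m b] n show False
      by (metis dvd_diff_right_iff)
  qed
  have "B (k + 0) a" using approx by (simp add: B_def)
  then have "\<exists>s. \<forall>j. (B (k + j) (s j) \<and> (j = 0 \<longrightarrow> s j = a)) \<and> int p ^ (k + j) dvd s (Suc j) - s j"
  proof (intro dependent_nat_choice)
    show "\<exists>s. B (k + 0) s \<and> (0 = 0 \<longrightarrow> s = a)" using \<open>B (k + 0) a\<close> by blast
    show "\<exists>y. (B (k + Suc j) y \<and> (Suc j = 0 \<longrightarrow> y = a)) \<and> int p ^ (k + j) dvd y - x"
      if "B (k + j) x \<and> (j = 0 \<longrightarrow> x = a)" for x j
      using step[of "k + j" x] that by auto
  qed
  then obtain s where s: "\<And>j. B (k + j) (s j)" "s 0 = a"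
      "\<And>j. int p ^ (k + j) dvd s (Suc j) - s j"
    by blast
  have s': "int p ^ j dvd s (Suc j) - s j" for j
    using s(3)[of j] by (rule dvd_trans[rotated]) (simp add: le_imp_power_dvd)
  obtain u where u: "zp_digits p u" "\<And>i. int p ^ i dvd zp_res p i u - s i"
    using zp_complete[of p s, OF p s'] by blast
  have sk: "int p ^ k dvd s j - a" for j
  proof (induction j)
    case (Suc j)
    have "int p ^ k dvd s (Suc j) - s j"
      using s(3)[of j] by (rule dvd_trans[rotated]) (simp add: le_imp_power_dvd)
    from dvd_add[OF this Suc] show ?case by simp
  qed (simp add: s(2))
  have "int p ^ k dvd zp_res p k u - a" using dvd_add[OF u(2)[of k] sk[of k]] by simp
  moreover have "qp_is_root p n c (m, u)"
    unfolding qp_is_root_iff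
  proof
    fix K
    obtain b where b: "int p ^ (k + K) dvd b - s K" "int p ^ K dvd poly (zp_poly p n c m K) b"
      using s(1)[of K] unfolding B_def by blast
    have "int p ^ K dvd b - s K"
      using b(1) by (rule dvd_trans[rotated]) (simp add: le_imp_power_dvd)
    then have "int p ^ K dvd zp_res p K u - b"
      using dvd_diff[OF u(2)[of K]] by fastforce
    from poly_diff_dvd[OF this, of "zp_poly p n c m K"] b(2)
    show "int p ^ K dvd poly (zp_poly p n c m K) (zp_res p K u)"
      by (metis dvd_diff_left_iff)
  qed
  ultimately show thesis using that u(1) by blast
qed

lemma hensel_root_exists:
  assumes p: "prime p" and h: "hensel_class p k (zp_poly p n c m (2 * k)) a"
  obtains u where "zp_digits p u" "int p ^ k dvd zp_res p k u - a" "qp_is_root p n c (m, u)"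
proof (rule zp_root_compactness)
  show "p > 0" using p by (simp add: prime_gt_0_nat)
  fix K
  define L where "L = max (2 * k) K"
  have "hensel_class p k (zp_poly p n c m L) a"
    using h hensel_class_zp_poly_cong[of k L] by (simp add: L_def)
  moreover have "k \<le> L" by (simp add: L_def)
  ultimately obtain b where b: "int p ^ k dvd b - a" "hensel_class p L (zp_poly p n c m L) b"
    using hensel_approx[OF p] by blast
  have "int p ^ L dvd poly (zp_poly p n c m L) b"
    using b(2) by (auto simp: hensel_class_def hensel_pair_def power_add dest: dvd_mult_left)
  then have "int p ^ K dvd poly (zp_poly p n c m L) b"
    by (rule dvd_trans[rotated]) (simp add: le_imp_power_dvd L_def)
  moreover have "int p ^ K dvd poly (zp_poly p n c m L) b - poly (zp_poly p n c m K) b"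
    by (rule zp_poly_cong) (simp add: L_def)
  ultimately have "int p ^ K dvd poly (zp_poly p n c m K) b"
    by (metis dvd_diff_right_iff)
  then show "\<exists>b. int p ^ k dvd b - a \<and> int p ^ K dvd poly (zp_poly p n c m K) b"
    using b(1) by blast
qed (use that in blast)

text \<open>If u and v differ by D of valuation j \<ge> k > \<mu>, then f(u) - f(v) = D f'(v) + D^2
  q, where the first term has valuation exactly j + \<mu> and the second at least 2 j > j + \<mu>.
  So the difference cannot vanish to arbitrary precision.\<close>

lemma hensel_root_unique:
  assumes p: "prime p" and h: "hensel_class p k (zp_poly p n c m (2 * k)) a"
    and u: "zp_digits p u" "int p ^ k dvd zp_res p k u - a" "qp_is_root p n c (m, u)"
    and v: "zp_digits p v" "int p ^ k dvd zp_res p k v - a" "qp_is_root p n c (m, v)"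
  shows "u = v"
proof (rule ccontr)
  assume "u \<noteq> v"
  then obtain j0 where j0: "\<not> int p ^ j0 dvd zp_res p j0 u - zp_res p j0 v"
    using zp_digits_eqI[OF u(1) v(1)] by blast
  have p0: "int p \<noteq> 0" using p by auto
  \<comment> \<open>L has to reach 2k, where the Hensel condition is stated, and j0, where u and v
    differ, and to exceed j + \<mu>, which is less than j0 + k.\<close>
  define L where "L = 2 * k + j0 + k"
  define D where "D = zp_res p L u - zp_res p L v"
  have red: "int p ^ i dvd D \<longleftrightarrow> int p ^ i dvd zp_res p i u - zp_res p i v" if "i \<le> L" for i
  proof -
    have "int p ^ i dvd (zp_res p L u - zp_res p i u) - (zp_res p L v - zp_res p i v)"
      by (intro dvd_diff zp_res_cong that)
    moreover have "(zp_res p L u - zp_res p i u) - (zp_res p L v - zp_res p i v) =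
       D - (zp_res p i u - zp_res p i v)" by (simp add: D_def)
    ultimately show ?thesis by (metis dvd_diff_left_iff dvd_diff_right_iff)
  qed
  have nD: "\<not> int p ^ j0 dvd D" using j0 red[of j0] by (simp add: L_def)
  have kD: "int p ^ k dvd D"
    using red[of k] dvd_diff[OF u(2) v(2)] by (simp add: L_def)
  define j where "j = multiplicity (int p) D"
  have D0: "D \<noteq> 0" using nD by auto
  have up: "\<not> is_unit (int p)" using p by (metis not_prime_unit prime_nat_int_transfer)
  have j1: "k \<le> j" using kD unfolding j_def using D0 up by (simp add: power_dvd_iff_le_multiplicity)
  have j2: "j < j0" using nD unfolding j_def
    using D0 up by (meson multiplicity_dvd' not_le_imp_less)
  obtain E where E: "D = int p ^ j * E" "\<not> int p dvd E"
    unfolding j_def using multiplicity_decompose'[of D "int p"] D0 up by metis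
  define f where "f = zp_poly p n c m L"
  define b where "b = zp_res p L v"
  have "hensel_class p k f a"
    using h hensel_class_zp_poly_cong[of k L] by (simp add: L_def f_def)
  then obtain \<mu> where \<mu>: "\<mu> < k" "int p ^ \<mu> dvd poly (pderiv f) a" "\<not> int p ^ Suc \<mu> dvd poly (pderiv f) a"
    by (auto simp: hensel_class_def hensel_pair_def)
  have ba: "int p ^ k dvd b - a"
  proof -
    have "int p ^ k dvd b - zp_res p k v" unfolding b_def by (rule zp_res_cong) (simp add: L_def)
    from dvd_add[OF this v(2)] show ?thesis by simp
  qed
  have "int p ^ k dvd poly (pderiv f) b - poly (pderiv f) a" using ba by (rule poly_diff_dvd)
  then have "int p ^ \<mu> dvd poly (pderiv f) b - poly (pderiv f) a"
     "int p ^ Suc \<mu> dvd poly (pderiv f) b - poly (pderiv f) a"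
    using \<mu>(1) by (meson dvd_trans le_imp_power_dvd less_imp_le Suc_leI)+
  with \<mu>(2,3) have "int p ^ \<mu> dvd poly (pderiv f) b" "\<not> int p ^ Suc \<mu> dvd poly (pderiv f) b"
    by (metis dvd_diff_left_iff dvd_diff_right_iff)+
  then obtain y where y: "poly (pderiv f) b = int p ^ \<mu> * y" "\<not> int p dvd y"
    by (metis dvdE mult.commute mult_dvd_mono dvd_refl power_Suc2)
  obtain q where q: "poly f (b + D) = poly f b + D * poly (pderiv f) b + D\<^sup>2 * q"
    by (rule poly_taylor2)
  have bD: "b + D = zp_res p L u" by (simp add: b_def D_def)
  have "int p ^ L dvd poly f (b + D) - poly f b"
    using u(3) v(3) unfolding bD unfolding b_def f_def qp_is_root_iff by (intro dvd_diff) auto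
  then have "int p ^ L dvd D * poly (pderiv f) b + D\<^sup>2 * q" by (simp add: q)
  moreover have "D * poly (pderiv f) b + D\<^sup>2 * q
      = int p ^ (j + \<mu>) * (E * (y + int p * (int p ^ (j - \<mu> - 1) * E * q)))"
  proof -
    have "j = \<mu> + Suc (j - \<mu> - 1)" using j1 \<mu>(1) by simp
    then have *: "int p ^ j = int p ^ \<mu> * (int p * int p ^ (j - \<mu> - 1))"
      by (metis power_add power_Suc)
    have "D\<^sup>2 * q = int p ^ j * (int p ^ \<mu> * (int p * int p ^ (j - \<mu> - 1))) * (E * E * q)"
      unfolding *[symmetric] E(1) by (simp add: power2_eq_square)
    then show ?thesis by (simp add: y(1) E(1) power_add algebra_simps)
  qed
  moreover have "Suc (j + \<mu>) \<le> L" using \<mu>(1) j2 by (simp add: L_def)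
  then have "int p ^ (j + \<mu>) * int p dvd int p ^ L"
    by (metis le_imp_power_dvd power_Suc2)
  ultimately have "int p ^ (j + \<mu>) * int p dvd
      int p ^ (j + \<mu>) * (E * (y + int p * (int p ^ (j - \<mu> - 1) * E * q)))"
    by (metis dvd_trans)
  then have "int p dvd E * (y + int p * (int p ^ (j - \<mu> - 1) * E * q))"
    using p0 by simp
  moreover have "prime (int p)" using p by simp
  ultimately have "int p dvd y + int p * (int p ^ (j - \<mu> - 1) * E * q)"
    using E(2) prime_dvd_mult_iff by blast
  then show False using y(2) by (simp add: dvd_add_left_iff)
qed

section \<open>Reduced fractions as representatives of the elements of Q_p\<close>

definition reduced_roots :: "nat \<Rightarrow> nat \<Rightarrow> (nat \<Rightarrow> nat \<Rightarrow> nat) \<Rightarrow> (nat \<times> (nat \<Rightarrow> nat)) set" where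
  "reduced_roots p n c =
     {(m, u). zp_digits p u \<and> (m = 0 \<or> u 0 \<noteq> 0) \<and> qp_is_root p n c (m, u)}"

lemma qp_eq_refl: "qp_eq p x x"
  by (simp add: qp_eq_def)

lemma qp_eq_sym: "qp_eq p x y \<Longrightarrow> qp_eq p y x"
  unfolding qp_eq_def by (metis dvd_eq_mod_eq_0 dvd_diff_commute)

lemma qp_eq_trans:
  assumes p: "p > 0" and xy: "qp_eq p x y" and yz: "qp_eq p y z"
  shows "qp_eq p x z"
  unfolding qp_eq_def dvd_eq_mod_eq_0[symmetric]
proof
  fix k
  \<comment> \<open>Cancelling the denominator p^(fst y) of the middle term costs that many digits
    of precision.\<close>
  define K where "K = k + fst y"
  let ?X = "zp_res p K (snd x)" and ?Y = "zp_res p K (snd y)" and ?Z = "zp_res p K (snd z)"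
  have "int p ^ K dvd ?X * int p ^ fst y - ?Y * int p ^ fst x"
       "int p ^ K dvd ?Y * int p ^ fst z - ?Z * int p ^ fst y"
    using xy yz by (auto simp: qp_eq_def dvd_eq_mod_eq_0)
  then have "int p ^ K dvd (?X * int p ^ fst y - ?Y * int p ^ fst x) * int p ^ fst z
      + (?Y * int p ^ fst z - ?Z * int p ^ fst y) * int p ^ fst x"
    by (intro dvd_add dvd_mult2)
  also have "(?X * int p ^ fst y - ?Y * int p ^ fst x) * int p ^ fst z
      + (?Y * int p ^ fst z - ?Z * int p ^ fst y) * int p ^ fst x
      = (?X * int p ^ fst z - ?Z * int p ^ fst x) * int p ^ fst y"
    by (simp add: algebra_simps)
  finally have "int p ^ k dvd ?X * int p ^ fst z - ?Z * int p ^ fst x"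
    using p by (simp add: K_def power_add)
  moreover have "int p ^ k dvd (?X - zp_res p k (snd x)) * int p ^ fst z
      - (?Z - zp_res p k (snd z)) * int p ^ fst x"
    by (intro dvd_diff dvd_mult2 zp_res_cong) (auto simp: K_def)
  ultimately have "int p ^ k dvd ?X * int p ^ fst z - ?Z * int p ^ fst x -
     ((?X - zp_res p k (snd x)) * int p ^ fst z
      - (?Z - zp_res p k (snd z)) * int p ^ fst x)"
    by (rule dvd_diff)
  then show "int p ^ k dvd zp_res p k (snd x) * int p ^ fst z - zp_res p k (snd z) * int p ^ fst x"
    by (simp add: algebra_simps)
qed

lemma qp_eq_shift:
  assumes "u 0 = 0"
  shows "qp_eq p (Suc m, u) (m, \<lambda>j. u (Suc j))"
  unfolding qp_eq_def dvd_eq_mod_eq_0[symmetric]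
proof
  fix k
  have "zp_res p (Suc k) u = int p * zp_res p k (\<lambda>j. u (Suc j))"
    using assms by (simp add: zp_res_Suc_shift)
  moreover have "int p ^ k dvd zp_res p (Suc k) u - zp_res p k u"
    by (rule zp_res_cong) simp
  ultimately have "int p ^ k dvd (zp_res p k u - int p * zp_res p k (\<lambda>j. u (Suc j))) * int p ^ m"
    by (metis dvd_diff_commute dvd_mult2)
  then show "int p ^ k dvd zp_res p k (snd (Suc m, u)) * int p ^ fst (m, \<lambda>j. u (Suc j))
      - zp_res p k (snd (m, \<lambda>j. u (Suc j))) * int p ^ fst (Suc m, u)"
    by (simp add: algebra_simps)
qed

lemma qp_is_root_shift:
  assumes p: "p > 0" and u: "u 0 = 0" and root: "qp_is_root p n c (Suc m, u)"
  shows "qp_is_root p n c (m, \<lambda>j. u (Suc j))"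
  unfolding qp_is_root_iff
proof
  fix k
  let ?v = "\<lambda>j. u (Suc j)"
  \<comment> \<open>Replacing m by m + 1 and the argument b by p b multiplies the scaled polynomial
    by p^n; cancelling this factor costs n digits.\<close>
  define K where "K = k + n"
  have r: "zp_res p (Suc K) u = int p * zp_res p K ?v"
    using u by (simp add: zp_res_Suc_shift)
  have *: "poly (scaled_poly p n (Suc m) w) (int p * b) = int p ^ n * poly (scaled_poly p n m w) b" for w b
    unfolding poly_scaled_poly sum_distrib_left
  proof (rule sum.cong)
    fix i assume "i \<in> {..n}"
    then have "Suc m * (n - i) + i = n + m * (n - i)" by simp
    then have "int p ^ (Suc m * (n - i)) * int p ^ i = int p ^ n * int p ^ (m * (n - i))"
      by (metis power_add)
    then show "w i * int p ^ (Suc m * (n - i)) * (int p * b) ^ i =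
         int p ^ n * (w i * int p ^ (m * (n - i)) * b ^ i)"
      unfolding power_mult_distrib by (metis mult.assoc mult.left_commute)
  qed simp
  have "int p ^ Suc K dvd int p ^ n * poly (zp_poly p n c m (Suc K)) (zp_res p K ?v)"
    using root[unfolded qp_is_root_iff, rule_format, of "Suc K"]
    unfolding r zp_poly_def * .
  then have "int p ^ Suc k dvd poly (zp_poly p n c m (Suc K)) (zp_res p K ?v)"
    using p unfolding K_def add_Suc[symmetric] by (simp add: power_add mult.commute)
  then have 1: "int p ^ k dvd poly (zp_poly p n c m (Suc K)) (zp_res p K ?v)"
    by (rule dvd_trans[rotated]) (simp add: le_imp_power_dvd)
  have "k \<le> Suc K" "k \<le> K" by (simp_all add: K_def)
  from zp_poly_cong(1)[OF this(1)] 1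
  have "int p ^ k dvd poly (zp_poly p n c m k) (zp_res p K ?v)"
    by (metis dvd_diff_right_iff)
  moreover have "int p ^ k dvd poly (zp_poly p n c m k) (zp_res p K ?v)
       - poly (zp_poly p n c m k) (zp_res p k ?v)"
    by (intro poly_diff_dvd zp_res_cong) fact
  ultimately show "int p ^ k dvd poly (zp_poly p n c m k) (zp_res p k ?v)"
    by (metis dvd_diff_right_iff)
qed

lemma reduced_root_exists:
  assumes p: "p > 0" and "zp_digits p u" "qp_is_root p n c (m, u)"
  shows "\<exists>y\<in>reduced_roots p n c. qp_eq p (m, u) y"
  using assms(2,3)
proof (induction m arbitrary: u)
  case 0
  then show ?case by (intro bexI[of _ "(0, u)"]) (auto simp: reduced_roots_def qp_eq_refl)
next
  case (Suc m)
  show ?case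
  proof (cases "u 0 = 0")
    case True
    have "zp_digits p (\<lambda>j. u (Suc j))" using Suc.prems by (simp add: zp_digits_def)
    from Suc.IH[OF this qp_is_root_shift[OF p _ Suc.prems(2)]] True
    obtain y where "y \<in> reduced_roots p n c" "qp_eq p (m, \<lambda>j. u (Suc j)) y" by blast
    then show ?thesis
      using qp_eq_trans[OF p qp_eq_shift[of u p m]] True by blast
  next
    case False
    then show ?thesis using Suc.prems
      by (intro bexI[of _ "(Suc m, u)"]) (auto simp: reduced_roots_def qp_eq_refl)
  qed
qed

text \<open>If m < m', then u p^m' = u' p^m forces p to divide u', although u' / p^m' is reduced
  with a nontrivial denominator.\<close>

lemma reduced_denominator_le:
  assumes p: "p > 0" and eq: "qp_eq p (m, u) (m', u')"
    and red: "zp_digits p u'" "m' = 0 \<or> u' 0 \<noteq> 0"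
  shows "m' \<le> m"
proof (rule ccontr)
  assume "\<not> m' \<le> m"
  then have m: "m < m'" by simp
  have "int p ^ Suc m dvd zp_res p (Suc m) u * int p ^ m' - zp_res p (Suc m) u' * int p ^ m"
    using eq by (auto simp: qp_eq_def dvd_eq_mod_eq_0 simp del: power_Suc)
  moreover have "int p ^ Suc m dvd zp_res p (Suc m) u * int p ^ m'"
    using m by (intro dvd_mult le_imp_power_dvd) simp
  ultimately have "int p ^ Suc m dvd zp_res p (Suc m) u' * int p ^ m"
    by (metis dvd_diff_right_iff)
  then have "int p dvd zp_res p (Suc m) u'" using p by simp
  then have "int p dvd int (u' 0)" by (simp add: zp_res_Suc_shift dvd_add_left_iff)
  moreover have "u' 0 < p" using red(1) by (simp add: zp_digits_def)
  ultimately have "u' 0 = 0" by (auto dest: dvd_imp_le)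
  then show False using red m by simp
qed

lemma num_roots_eq_card_reduced_roots:
  assumes p: "p > 0"
  shows "num_roots p n c = card (reduced_roots p n c)"
proof -
  define cls where "cls x = {y. zp_digits p (snd y) \<and> qp_eq p x y}" for x
  define Z where "Z = {x. zp_digits p (snd x) \<and> qp_is_root p n c x}"
  have cls_eq: "cls x = cls y" if "qp_eq p x y" for x y
    using qp_eq_trans[OF p that] qp_eq_trans[OF p qp_eq_sym[OF that]] unfolding cls_def by auto
  have "cls ` Z = cls ` reduced_roots p n c"
  proof
    show "cls ` Z \<subseteq> cls ` reduced_roots p n c"
    proof
      fix X assume "X \<in> cls ` Z"
      then obtain m u where "X = cls (m, u)" "zp_digits p u" "qp_is_root p n c (m, u)"
        by (auto simp: Z_def)
      moreover from this obtain y where "y \<in> reduced_roots p n c" "qp_eq p (m, u) y"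
        using reduced_root_exists[OF p] by metis
      ultimately show "X \<in> cls ` reduced_roots p n c" using cls_eq by (metis imageI)
    qed
    show "cls ` reduced_roots p n c \<subseteq> cls ` Z"
      by (intro image_mono) (auto simp: reduced_roots_def Z_def)
  qed
  moreover have "inj_on cls (reduced_roots p n c)"
  proof (rule inj_onI)
    fix x1 y1 assume x1: "x1 \<in> reduced_roots p n c" and y1: "y1 \<in> reduced_roots p n c"
      and e: "cls x1 = cls y1"
    obtain m u m' u' where xy: "x1 = (m, u)" "y1 = (m', u')" by fastforce
    note x = x1[unfolded xy] and y = y1[unfolded xy]
    have "(m', u') \<in> cls (m', u')" using y by (simp add: cls_def reduced_roots_def qp_eq_refl)
    then have "(m', u') \<in> cls (m, u)" using e unfolding xy by blast
    then have eq: "qp_eq p (m, u) (m', u')" by (simp add: cls_def)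
    have m: "m = m'"
      using reduced_denominator_le[OF p eq] reduced_denominator_le[OF p qp_eq_sym[OF eq]] x y
      by (auto simp: reduced_roots_def intro: antisym)
    have "u = u'"
    proof (rule zp_digits_eqI)
      fix k
      have "int p ^ (k + m) dvd zp_res p (k + m) u * int p ^ m - zp_res p (k + m) u' * int p ^ m"
        using eq m by (auto simp: qp_eq_def dvd_eq_mod_eq_0)
      then have "int p ^ k dvd zp_res p (k + m) u - zp_res p (k + m) u'"
        using p by (simp add: power_add flip: left_diff_distrib)
      moreover have "int p ^ k dvd (zp_res p (k + m) u - zp_res p k u) - (zp_res p (k + m) u' - zp_res p k u')"
        by (intro dvd_diff zp_res_cong) auto
      ultimately have "int p ^ k dvd (zp_res p (k + m) u - zp_res p (k + m) u') -
         ((zp_res p (k + m) u - zp_res p k u) - (zp_res p (k + m) u' - zp_res p k u'))"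
        by (rule dvd_diff)
      then show "int p ^ k dvd zp_res p k u - zp_res p k u'" by simp
    qed (use x y in \<open>auto simp: reduced_roots_def\<close>)
    with m show "x1 = y1" by (simp add: xy)
  qed
  moreover have "num_roots p n c = card (cls ` Z)"
    unfolding num_roots_def Z_def cls_def ..
  ultimately show ?thesis by (simp add: card_image)
qed

section \<open>Counting roots by residue classes\<close>

text \<open>A label (m, a) stands for the residue class modulo p^k of the numerator u of the reduced
  fraction u / p^m.\<close>

definition labels :: "nat \<Rightarrow> nat \<Rightarrow> (nat \<times> nat) set" where
  "labels p k = {(m, a). m < k \<and> a < p ^ k \<and> (m = 0 \<or> \<not> p dvd a)}"

definition hensel_labels :: "nat \<Rightarrow> nat \<Rightarrow> (nat \<Rightarrow> nat \<Rightarrow> nat) \<Rightarrow> nat \<Rightarrow> (nat \<times> nat) set" where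
  "hensel_labels p n c k =
     {s \<in> labels p k. hensel_class p k (zp_poly p n c (fst s) (2 * k)) (int (snd s))}"

text \<open>The link between Hensel labels, which finitely many digits decide, and actual roots: it
  contains the Hensel labels of level k, and its eventual cardinality detects a positive number of
  roots.\<close>

definition root_labels :: "nat \<Rightarrow> nat \<Rightarrow> (nat \<Rightarrow> nat \<Rightarrow> nat) \<Rightarrow> nat \<Rightarrow> (nat \<times> nat) set" where
  "root_labels p n c k =
     {s \<in> labels p k. \<exists>u. zp_digits p u \<and> zp_res p k u = int (snd s) \<and> qp_is_root p n c (fst s, u)}"

text \<open>The first alternative takes care of the roots with denominator at least p^k.\<close>

definition exceptional :: "nat \<Rightarrow> nat \<Rightarrow> (nat \<Rightarrow> nat \<Rightarrow> nat) \<Rightarrow> nat \<Rightarrow> bool" where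
  "exceptional p n c k \<longleftrightarrow> int p ^ k dvd zp_res p k (c n) \<or>
     (\<exists>(m, a)\<in>labels p k. int p ^ (2 * k) dvd poly (zp_poly p n c m (2 * k)) (int a))"

definition label_of :: "nat \<Rightarrow> nat \<Rightarrow> nat \<times> (nat \<Rightarrow> nat) \<Rightarrow> nat \<times> nat" where
  "label_of p k x = (fst x, nat (zp_res p k (snd x)))"

lemma labels_subset: "labels p k \<subseteq> {..<k} \<times> {..<p ^ k}"
  by (auto simp: labels_def)

lemma finite_labels [simp]: "finite (labels p k)"
  by (rule finite_subset[OF labels_subset]) simp

lemma finite_hensel_labels [simp]: "finite (hensel_labels p n c k)"
  by (rule finite_subset[OF _ finite_labels[of p k]]) (auto simp: hensel_labels_def)

lemma finite_root_labels [simp]: "finite (root_labels p n c k)"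
  by (rule finite_subset[OF _ finite_labels[of p k]]) (auto simp: root_labels_def)

lemma labels_0 [simp]: "labels p 0 = {}"
  by (auto simp: labels_def)

lemma zp_res_eq_iff_dvd:
  assumes "zp_digits p u" "a < p ^ k"
  shows "int p ^ k dvd zp_res p k u - int a \<longleftrightarrow> zp_res p k u = int a"
proof
  assume d: "int p ^ k dvd zp_res p k u - int a"
  have "int a < int p ^ k" using assms(2) by (metis of_nat_less_iff of_nat_power)
  then have "\<bar>zp_res p k u - int a\<bar> < int p ^ k"
    using zp_res_range[OF assms(1), of k] by linarith
  with d show "zp_res p k u = int a"
    by (metis abs_ge_zero dvd_abs_iff abs_0_eq eq_iff_diff_eq_0 less_le zdvd_not_zless)
qed simp

lemma zp_unit_iff:
  assumes "k > 0" "zp_digits p u" "zp_res p k u = int a"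
  shows "u 0 \<noteq> 0 \<longleftrightarrow> \<not> p dvd a"
proof -
  obtain j where k: "k = Suc j" using assms(1) gr0_implies_Suc by blast
  have "int a = int (u 0) + int p * zp_res p j (\<lambda>j. u (Suc j))"
    using assms(3) by (simp add: k zp_res_Suc_shift)
  then have "int p dvd int a \<longleftrightarrow> int p dvd int (u 0)" by (simp add: dvd_add_left_iff)
  moreover have "u 0 < p" using assms(2) by (simp add: zp_digits_def)
  ultimately show ?thesis by (cases "u 0 = 0") (auto dest: dvd_imp_le)
qed

lemma hensel_labels_subset_root_labels:
  assumes p: "prime p"
  shows "hensel_labels p n c k \<subseteq> root_labels p n c k"
proof
  fix s assume s: "s \<in> hensel_labels p n c k"
  obtain m a where ma: "s = (m, a)" by fastforce
  have h: "hensel_class p k (zp_poly p n c m (2 * k)) (int a)" and a: "a < p ^ k"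
    using s by (auto simp: hensel_labels_def ma labels_def)
  obtain u where "zp_digits p u" "int p ^ k dvd zp_res p k u - int a" "qp_is_root p n c (m, u)"
    using hensel_root_exists[OF p h] .
  then show "s \<in> root_labels p n c k"
    using s zp_res_eq_iff_dvd[OF _ a] by (auto simp: root_labels_def hensel_labels_def ma)
qed

lemma root_labels_eq_image:
  "root_labels p n c k = label_of p k ` {x \<in> reduced_roots p n c. fst x < k}"
proof (cases "k = 0")
  case True
  then show ?thesis by (auto simp: root_labels_def)
next
  case False
  show ?thesis
  proof
    show "root_labels p n c k \<subseteq> label_of p k ` {x \<in> reduced_roots p n c. fst x < k}"
    proof
      fix s assume s: "s \<in> root_labels p n c k"
      obtain m a where ma: "s = (m, a)" by fastforce
      obtain u where u: "zp_digits p u" "zp_res p k u = int a" "qp_is_root p n c (m, u)"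
        using s by (auto simp: root_labels_def ma)
      have "m < k" "m = 0 \<or> \<not> p dvd a" using s by (auto simp: root_labels_def labels_def ma)
      with u have "(m, u) \<in> {x \<in> reduced_roots p n c. fst x < k}"
        using zp_unit_iff[of k p u a] False by (auto simp: reduced_roots_def)
      moreover have "s = label_of p k (m, u)" by (simp add: label_of_def u ma)
      ultimately show "s \<in> label_of p k ` {x \<in> reduced_roots p n c. fst x < k}" by blast
    qed
    show "label_of p k ` {x \<in> reduced_roots p n c. fst x < k} \<subseteq> root_labels p n c k"
    proof
      fix s assume "s \<in> label_of p k ` {x \<in> reduced_roots p n c. fst x < k}"
      then obtain m u where mu: "(m, u) \<in> reduced_roots p n c" "m < k" "s = label_of p k (m, u)"
        by auto
      have u: "zp_digits p u" "m = 0 \<or> u 0 \<noteq> 0" "qp_is_root p n c (m, u)"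
        using mu by (auto simp: reduced_roots_def)
      define a where "a = nat (zp_res p k u)"
      have a: "zp_res p k u = int a" using zp_res_range[OF u(1)] by (simp add: a_def)
      have "a < p ^ k" using zp_res_range(2)[OF u(1), of k] unfolding a
        by (metis of_nat_less_iff of_nat_power)
      then show "s \<in> root_labels p n c k"
        using mu(2) u a zp_unit_iff[of k p u a] False
        by (auto simp: root_labels_def labels_def mu(3) label_of_def)
    qed
  qed
qed

lemma card_root_labels_le:
  assumes "finite (reduced_roots p n c)"
  shows "card (root_labels p n c k) \<le> card (reduced_roots p n c)"
  unfolding root_labels_eq_image
  by (rule order_trans[OF card_image_le card_mono]) (use assms in auto)

text \<open>For large k the denominators in F are below p^k and distinct numerators differ modulo
  p^k. A finite subset F is used so that infinite root sets are covered too.\<close>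

lemma eventually_card_root_labels_ge:
  assumes F: "finite F" "F \<subseteq> reduced_roots p n c"
  shows "\<forall>\<^sub>F k in sequentially. card F \<le> card (root_labels p n c k)"
proof -
  have "\<forall>\<^sub>F k in sequentially. label_of p k x \<noteq> label_of p k y" if F': "x \<in> F" "y \<in> F" and ne: "x \<noteq> y" for x y
  proof -
    obtain m u m' v where xy: "x = (m, u)" "y = (m', v)" by fastforce
    have d: "zp_digits p u" "zp_digits p v" using F' F xy by (auto simp: reduced_roots_def)
    show ?thesis
    proof (cases "m = m'")
      case True
      then obtain i where i: "\<not> int p ^ i dvd zp_res p i u - zp_res p i v"
        using zp_digits_eqI[OF d] ne xy by auto
      have "label_of p k x \<noteq> label_of p k y" if "i \<le> k" for k
      proof
        assume "label_of p k x = label_of p k y"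
        then have e: "zp_res p k u = zp_res p k v"
          using zp_res_range(1)[OF d(1), of k] zp_res_range(1)[OF d(2), of k]
          by (simp add: label_of_def xy nat_eq_iff)
        have "int p ^ i dvd (zp_res p k v - zp_res p i v) - (zp_res p k u - zp_res p i u)"
          by (intro dvd_diff zp_res_cong that)
        with e i show False by simp
      qed
      then show ?thesis by (auto simp: eventually_sequentially)
    qed (simp add: label_of_def xy)
  qed
  then have "\<forall>\<^sub>F k in sequentially. \<forall>x\<in>F. \<forall>y\<in>F. x \<noteq> y \<longrightarrow> label_of p k x \<noteq> label_of p k y"
    using F(1) by (intro eventually_ball_finite ballI) (auto simp: eventually_sequentially)
  moreover have "\<forall>\<^sub>F k in sequentially. \<forall>x\<in>F. fst x < k"
    using F(1) by (intro eventually_ball_finite ballI) (auto simp: eventually_gt_at_top)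
  ultimately show ?thesis
  proof eventually_elim
    case (elim k)
    have "inj_on (label_of p k) F" using elim(1) by (auto intro!: inj_onI)
    then have "card F = card (label_of p k ` F)" by (simp add: card_image)
    also have "\<dots> \<le> card (root_labels p n c k)"
      by (rule card_mono[OF finite_root_labels]) (use elim(2) F(2) in \<open>auto simp: root_labels_eq_image\<close>)
    finally show ?case .
  qed
qed

text \<open>The value 0 is left out because \<open>card\<close> is 0 on infinite sets:
  \<open>num_roots\<close> is then 0 while the number of labels exceeds every bound.\<close>

lemma num_roots_eq_iff_root_labels:
  assumes p: "p > 0" and r: "r > 0"
  shows "num_roots p n c = r \<longleftrightarrow> (\<forall>\<^sub>F k in sequentially. card (root_labels p n c k) = r)"
proof (cases "finite (reduced_roots p n c)")
  case True
  have "\<forall>\<^sub>F k in sequentially. card (root_labels p n c k) = num_roots p n c"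
    using eventually_card_root_labels_ge[OF True subset_refl]
    unfolding num_roots_eq_card_reduced_roots[OF p]
    by eventually_elim (use card_root_labels_le[OF True] in \<open>auto intro: antisym\<close>)
  note ev = this
  show ?thesis
  proof
    assume "\<forall>\<^sub>F k in sequentially. card (root_labels p n c k) = r"
    with ev have "\<forall>\<^sub>F k::nat in sequentially. num_roots p n c = r"
      by eventually_elim simp
    then show "num_roots p n c = r" by simp
  qed (use ev in simp)
next
  case False
  then obtain F where F: "finite F" "F \<subseteq> reduced_roots p n c" "card F = Suc r"
    by (meson infinite_arbitrarily_large)
  have "\<not> (\<forall>\<^sub>F k in sequentially. card (root_labels p n c k) = r)"
  proof
    assume "\<forall>\<^sub>F k in sequentially. card (root_labels p n c k) = r"
    with eventually_card_root_labels_ge[OF F(1,2)]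
    have "\<forall>\<^sub>F k::nat in sequentially. False" by eventually_elim (use F(3) in auto)
    then show False by simp
  qed
  then show ?thesis using r False by (auto simp: num_roots_eq_card_reduced_roots[OF p])
qed

text \<open>Expanding at a, the quadratic term drops out modulo p^(2k), so f(a) + (b - a) f'(a)
  vanishes there. As f(a) does not, p^k cannot divide f'(a). Its valuation \<mu> is thus below k,
  and p^(k + \<mu>) divides (b - a) f'(a), hence f(a).\<close>

lemma hensel_class_of_root:
  assumes a: "int p ^ k dvd a - b" and root: "int p ^ (2 * k) dvd poly f b"
    and na: "\<not> int p ^ (2 * k) dvd poly f a"
  shows "hensel_class p k f a"
proof -
  define h where "h = b - a"
  have h: "int p ^ k dvd h" using a by (simp add: h_def dvd_diff_commute)
  obtain q where "poly f (a + h) = poly f a + h * poly (pderiv f) a + h\<^sup>2 * q"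
    by (rule poly_taylor2)
  then have b: "poly f b = poly f a + h * poly (pderiv f) a + h\<^sup>2 * q" by (simp add: h_def)
  have "int p ^ (2 * k) dvd h\<^sup>2 * q"
    using dvd_power_same[OF h, of 2] by (simp add: mult.commute dvd_mult2 flip: power_mult)
  then have s: "int p ^ (2 * k) dvd poly f a + h * poly (pderiv f) a"
    using root unfolding b by (simp add: dvd_add_left_iff)
  have ndk: "\<not> int p ^ k dvd poly (pderiv f) a"
  proof
    assume "int p ^ k dvd poly (pderiv f) a"
    with h have "int p ^ (2 * k) dvd h * poly (pderiv f) a"
      by (simp add: mult_2 power_add mult_dvd_mono)
    with s na show False by (simp add: dvd_add_left_iff)
  qed
  define \<mu> where "\<mu> = (LEAST j. \<not> int p ^ Suc j dvd poly (pderiv f) a)"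
  have "k > 0" using ndk by (cases k) auto
  then have ex: "\<not> int p ^ Suc (k - 1) dvd poly (pderiv f) a" using ndk by simp
  have \<mu>1: "\<not> int p ^ Suc \<mu> dvd poly (pderiv f) a" unfolding \<mu>_def by (rule LeastI, rule ex)
  have \<mu>2: "\<mu> < k" using Least_le[of "\<lambda>j. \<not> int p ^ Suc j dvd poly (pderiv f) a", OF ex] \<open>k > 0\<close>
    unfolding \<mu>_def by linarith
  have \<mu>3: "int p ^ \<mu> dvd poly (pderiv f) a"
  proof (cases \<mu>)
    case (Suc j)
    then show ?thesis using not_less_Least[of j "\<lambda>j. \<not> int p ^ Suc j dvd poly (pderiv f) a"]
      by (auto simp: \<mu>_def)
  qed simp
  have "int p ^ (k + \<mu>) dvd poly f a + h * poly (pderiv f) a"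
    using s by (rule dvd_trans[rotated]) (use \<mu>2 in \<open>simp add: le_imp_power_dvd\<close>)
  moreover have "int p ^ (k + \<mu>) dvd h * poly (pderiv f) a"
    using h \<mu>3 by (simp add: power_add mult_dvd_mono)
  ultimately have "int p ^ (k + \<mu>) dvd poly f a" by (simp add: dvd_add_left_iff)
  then show ?thesis using \<mu>1 \<mu>2 \<mu>3 unfolding hensel_class_def hensel_pair_def by blast
qed

lemma not_exceptional_imp:
  assumes p: "prime p" and ne: "\<not> exceptional p n c k" and x: "x \<in> reduced_roots p n c"
  shows "label_of p k x \<in> hensel_labels p n c k"
proof -
  obtain m u where mu: "x = (m, u)" by fastforce
  have u: "zp_digits p u" "m = 0 \<or> u 0 \<noteq> 0" "qp_is_root p n c (m, u)"
    using x by (auto simp: reduced_roots_def mu)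
  have k: "k > 0" using ne by (cases k) (auto simp: exceptional_def)
  have pp: "prime (int p)" "p > 0" using p by (auto simp: prime_gt_0_nat)
  \<comment> \<open>For m \<ge> k every term except the leading one is divisible by p^k. The
    numerator is a unit, so p^k would divide the leading coefficient, which is the first exceptional
    case.\<close>
  have "m < k"
  proof (rule ccontr)
    assume mk: "\<not> m < k"
    define b where "b = zp_res p k u"
    have "int p ^ k dvd poly (zp_poly p n c m k) b"
      using u(3) by (auto simp: qp_is_root_iff b_def)
    moreover have "poly (zp_poly p n c m k) b =
        (\<Sum>i<n. zp_res p k (c i) * int p ^ (m * (n - i)) * b ^ i) + zp_res p k (c n) * b ^ n"
      by (simp add: zp_poly_def poly_scaled_poly flip: lessThan_Suc_atMost)
    moreover have "int p ^ k dvd (\<Sum>i<n. zp_res p k (c i) * int p ^ (m * (n - i)) * b ^ i)"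
    proof (rule dvd_sum)
      fix i assume "i \<in> {..<n}"
      then have "m * 1 \<le> m * (n - i)" by (intro mult_left_mono) auto
      with mk have "k \<le> m * (n - i)" by linarith
      then show "int p ^ k dvd zp_res p k (c i) * int p ^ (m * (n - i)) * b ^ i"
        by (intro dvd_mult2[OF dvd_mult] le_imp_power_dvd)
    qed
    ultimately have "int p ^ k dvd zp_res p k (c n) * b ^ n" by (simp add: dvd_add_right_iff)
    moreover have "coprime (int p ^ k) (b ^ n)"
    proof -
      have "\<not> int p dvd b"
        using zp_unit_iff[OF k u(1), of "nat b"] zp_res_range(1)[OF u(1), of k] u(2) mk k
        unfolding b_def by (auto simp flip: int_dvd_int_iff)
      then show ?thesis using pp(1) by (simp add: prime_imp_coprime)
    qed
    ultimately have "int p ^ k dvd zp_res p k (c n)" by (simp add: coprime_dvd_mult_left_iff)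
    with ne show False by (simp add: exceptional_def)
  qed
  then have "label_of p k x \<in> root_labels p n c k" using x by (auto simp: root_labels_eq_image mu)
  then have l: "label_of p k x \<in> labels p k" by (simp add: root_labels_def)
  have "hensel_class p k (zp_poly p n c m (2 * k)) (zp_res p k u)"
  proof (rule hensel_class_of_root)
    show "int p ^ k dvd zp_res p k u - zp_res p (2 * k) u"
      using zp_res_cong[of k "2 * k" p u] by (simp add: dvd_diff_commute)
    show "int p ^ (2 * k) dvd poly (zp_poly p n c m (2 * k)) (zp_res p (2 * k) u)"
      using u(3) by (simp add: qp_is_root_iff)
    have "\<not> int p ^ (2 * k) dvd poly (zp_poly p n c m (2 * k)) (int (nat (zp_res p k u)))"
      using ne l by (auto simp: exceptional_def label_of_def mu)
    then show "\<not> int p ^ (2 * k) dvd poly (zp_poly p n c m (2 * k)) (zp_res p k u)"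
      using zp_res_range(1)[OF u(1), of k] by simp
  qed
  then show ?thesis
    using l zp_res_range(1)[OF u(1), of k] by (simp add: hensel_labels_def label_of_def mu)
qed

text \<open>Every root has a Hensel label, different roots have different labels by uniqueness in
  Hensel's lemma, and every Hensel label comes from a root by existence.\<close>

lemma not_exceptional_num_roots:
  assumes p: "prime p" and ne: "\<not> exceptional p n c k"
  shows "finite (reduced_roots p n c)" "num_roots p n c = card (hensel_labels p n c k)"
proof -
  have pp: "p > 0" using p by (simp add: prime_gt_0_nat)
  have sub: "label_of p k ` reduced_roots p n c \<subseteq> hensel_labels p n c k"
    using not_exceptional_imp[OF p ne] by blast
  have inj: "inj_on (label_of p k) (reduced_roots p n c)"
  proof (rule inj_onI)
    fix x y assume x: "x \<in> reduced_roots p n c" and y: "y \<in> reduced_roots p n c"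
      and e: "label_of p k x = label_of p k y"
    obtain m u m' v where xy: "x = (m, u)" "y = (m', v)" by fastforce
    have m: "m' = m" using e by (simp add: label_of_def xy)
    have u: "zp_digits p u" "qp_is_root p n c (m, u)" and v: "zp_digits p v" "qp_is_root p n c (m, v)"
      using x y by (auto simp: reduced_roots_def xy m)
    have r: "zp_res p k v = zp_res p k u"
      using e zp_res_range(1)[OF u(1), of k] zp_res_range(1)[OF v(1), of k]
      by (simp add: label_of_def xy nat_eq_iff)
    have "hensel_class p k (zp_poly p n c m (2 * k)) (zp_res p k u)"
      using not_exceptional_imp[OF p ne x] zp_res_range(1)[OF u(1), of k]
      by (simp add: hensel_labels_def label_of_def xy)
    from hensel_root_unique[OF p this u(1) _ u(2) v(1) _ v(2)] r show "x = y" by (simp add: xy m)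
  qed
  show fin: "finite (reduced_roots p n c)"
    using finite_subset[OF sub] inj by (simp add: finite_image_iff)
  have "card (reduced_roots p n c) \<le> card (hensel_labels p n c k)"
    using card_mono[OF _ sub] inj by (simp add: card_image)
  moreover have "card (hensel_labels p n c k) \<le> card (reduced_roots p n c)"
    by (rule order_trans[OF card_mono card_root_labels_le[OF fin]])
       (use hensel_labels_subset_root_labels[OF p] in auto)
  ultimately show "num_roots p n c = card (hensel_labels p n c k)"
    by (simp add: num_roots_eq_card_reduced_roots[OF pp])
qed

lemma card_hensel_labels_le:
  assumes p: "prime p" and "finite (reduced_roots p n c)"
  shows "card (hensel_labels p n c k) \<le> num_roots p n c"
  unfolding num_roots_eq_card_reduced_roots[OF prime_gt_0_nat[OF p]]
  by (rule order_trans[OF card_mono card_root_labels_le[OF assms(2)]])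
     (use hensel_labels_subset_root_labels[OF p] in auto)

section \<open>Double zeros and interpolation of jets\<close>

definition coeff_poly :: "nat \<Rightarrow> (nat \<Rightarrow> 'a::comm_monoid_add) \<Rightarrow> 'a poly" where
  "coeff_poly n w = (\<Sum>i\<le>n. monom (w i) i)"

lemma coeff_coeff_poly: "coeff (coeff_poly n w) i = (if i \<le> n then w i else 0)"
  by (simp add: coeff_poly_def coeff_sum)

lemma poly_coeff_poly: "poly (coeff_poly n w) x = (\<Sum>i\<le>n. w i * x ^ i)"
  for w :: "nat \<Rightarrow> 'a::comm_ring_1"
  by (simp add: coeff_poly_def poly_sum poly_monom)

lemma scaled_poly_0: "scaled_poly p n 0 w = coeff_poly n w"
  by (simp add: scaled_poly_def coeff_poly_def)

text \<open>Bounding the remainder through its coefficients also covers a constant divisor, such as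
  the empty product below, where the remainder has to be 0.\<close>

lemma monic_division:
  fixes f g :: "'a::idom poly"
  assumes g: "lead_coeff g = 1"
  obtains q r where "f = g * q + r" "\<And>i. degree g \<le> i \<Longrightarrow> coeff r i = 0"
proof -
  have g0: "g \<noteq> 0" using g by auto
  obtain q r where qr: "pseudo_divmod f g = (q, r)" by fastforce
  have "f = g * q + r" using pseudo_divmod(1)[OF g0 qr] g by simp
  moreover have "coeff r i = 0" if "degree g \<le> i" for i
    using pseudo_divmod(2)[OF g0 qr] that by (auto intro: coeff_eq_0)
  ultimately show thesis by (rule that)
qed

definition double_zeros :: "int set \<Rightarrow> int poly" where
  "double_zeros A = (\<Prod>a\<in>A. [:-a, 1:]\<^sup>2)"

lemma lead_coeff_double_zeros: "lead_coeff (double_zeros A) = 1"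
  by (simp add: double_zeros_def lead_coeff_prod lead_coeff_power)

lemma degree_double_zeros: "degree (double_zeros A) = 2 * card A"
  unfolding double_zeros_def
  by (subst degree_prod_eq_sum_degree) (auto simp: degree_power_eq)

lemma double_zeros_division:
  obtains q r where "f = double_zeros A * q + r" "\<And>i. 2 * card A \<le> i \<Longrightarrow> coeff r i = 0"
  using monic_division[OF lead_coeff_double_zeros[of A], of f] unfolding degree_double_zeros by blast

text \<open>Modulo q every factor x - a is x. Applied with q = p to the points at infinity and with
  q = p^e to the roots in the monic models.\<close>

lemma double_zeros_cong:
  assumes "finite A" "\<And>a. a \<in> A \<Longrightarrow> q dvd a"
  shows "\<exists>h. double_zeros A = monom 1 (2 * card A) + smult q h"
  using assms
proof (induction A)
  case empty
  then show ?case by (intro exI[of _ 0]) (simp add: double_zeros_def)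
next
  case (insert a A)
  then obtain h where h: "double_zeros A = monom 1 (2 * card A) + smult q h" by auto
  obtain b where b: "a = q * b" using insert.prems by blast
  define X where "X = monom (1::int) 1"
  define Y where "Y = monom (1::int) (2 * card A)"
  define Q where "Q = [:q:]"
  define b' where "b' = [:b:]"
  have Q: "smult q r = Q * r" for r by (simp add: Q_def)
  have "[:-a, 1:] = X - Q * b'"
    by (simp add: b X_def Q_def b'_def monom_altdef)
  then have "double_zeros (insert a A) = (X - Q * b')\<^sup>2 * (Y + Q * h)"
    using insert.hyps h by (simp add: double_zeros_def Y_def Q)
  also have "\<dots> = X\<^sup>2 * Y + smult q (X\<^sup>2 * h + (Q * b'\<^sup>2 - 2 * X * b') * (Y + Q * h))"
    unfolding Q by (simp add: power2_eq_square algebra_simps)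
  also have "X\<^sup>2 * Y = monom 1 (2 * card (insert a A))"
    using insert.hyps by (simp add: X_def Y_def power2_eq_square mult_monom)
  finally show ?case by blast
qed

text \<open>The kernel of the map \<open>jet\<close> introduced below; it contains the multiples of
  M and, for finite A, those of \<open>double_zeros A\<close>.\<close>

definition null_jet :: "int \<Rightarrow> int set \<Rightarrow> int poly \<Rightarrow> bool" where
  "null_jet M A u \<longleftrightarrow> (\<forall>a\<in>A. M dvd poly u a \<and> M dvd poly (pderiv u) a)"

lemma null_jet_add: "null_jet M A u \<Longrightarrow> null_jet M A v \<Longrightarrow> null_jet M A (u + v)"
  by (auto simp: null_jet_def pderiv_add)

lemma null_jet_diff: "null_jet M A u \<Longrightarrow> null_jet M A v \<Longrightarrow> null_jet M A (u - v)"
  by (auto simp: null_jet_def pderiv_diff)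

lemma null_jet_smult: "null_jet M A u \<Longrightarrow> null_jet M A (smult c u)"
  by (auto simp: null_jet_def pderiv_smult)

lemma null_jet_modulus: "null_jet M A (smult M u)"
  by (auto simp: null_jet_def pderiv_smult)

lemma null_jet_double_zeros:
  assumes "finite A"
  shows "null_jet M A (double_zeros A * h)"
  unfolding null_jet_def
proof
  fix a assume a: "a \<in> A"
  have "double_zeros A * h = [:-a, 1:] * ([:-a, 1:] * ((\<Prod>a\<in>A - {a}. [:-a, 1:]\<^sup>2) * h))"
    unfolding double_zeros_def prod.remove[OF assms a] power2_eq_square mult.assoc ..
  then obtain g where g: "double_zeros A * h = [:-a, 1:] * ([:-a, 1:] * g)" by blast
  show "M dvd poly (double_zeros A * h) a \<and> M dvd poly (pderiv (double_zeros A * h)) a"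
    unfolding g pderiv_mult by (simp del: mult_pCons_left)
qed

text \<open>The top coefficients are the reversed remainder t of v modulo H = double_zeros B; the bottom ones
  form the remainder l of u, minus the top part, modulo double_zeros A.  As H is congruent to
  x^(2 card B) modulo q, the contribution of l to the reversed polynomial is a multiple of q modulo H.\<close>

lemma jets_approx:
  assumes fin: "finite A" "finite B" and B: "\<And>b. b \<in> B \<Longrightarrow> q dvd b"
    and n: "2 * card A + 2 * card B \<le> Suc n"
  obtains w r where "null_jet M A (u - coeff_poly n w)"
    "null_jet M B (v - coeff_poly n (\<lambda>i. w (n - i)) - smult q r)"
proof -
  define k where "k = 2 * card B"
  \<comment> \<open>The n + 1 coefficient positions are split at L: the top k of them become the
    bottom k after reversal.\<close>
  define L where "L = Suc n - k"
  define G where "G = double_zeros A"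
  define H where "H = double_zeros B"
  have k: "k \<le> Suc n" "2 * card A \<le> L" using n by (auto simp: k_def L_def)
  obtain q2 t where t: "v = H * q2 + t" "\<And>i. k \<le> i \<Longrightarrow> coeff t i = 0"
    using double_zeros_division[of v B] unfolding H_def k_def by blast
  define T where "T = (\<Sum>i\<in>{L..n}. monom (coeff t (n - i)) i)"
  obtain q1 l where l: "u - T = G * q1 + l" "\<And>i. 2 * card A \<le> i \<Longrightarrow> coeff l i = 0"
    using double_zeros_division[of "u - T" A] unfolding G_def by blast
  define w where "w i = (if i < L then coeff l i else coeff t (n - i))" for i
  \<comment> \<open>z is the reversal of l within degree n - k; reversal within degree n therefore
    turns l into x^k z.\<close>
  define z where "z = (\<Sum>j<L. monom (coeff l (n - k - j)) j)"
  have cT: "coeff T i = (if L \<le> i \<and> i \<le> n then coeff t (n - i) else 0)" for i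
    by (simp add: T_def coeff_sum)
  have cz: "coeff z j = (if j < L then coeff l (n - k - j) else 0)" for j
    by (simp add: z_def coeff_sum)
  have "coeff_poly n w = l + T"
  proof (rule poly_eqI)
    fix i show "coeff (coeff_poly n w) i = coeff (l + T) i"
      using l(2)[of i] k by (auto simp: coeff_coeff_poly cT w_def L_def)
  qed
  then have 1: "u - coeff_poly n w = G * q1" using l(1) by (simp add: algebra_simps)
  obtain h where h: "H = monom 1 k + smult q h"
    using double_zeros_cong[OF fin(2) B] by (auto simp: H_def k_def)
  have "coeff_poly n (\<lambda>i. w (n - i)) = t + monom 1 k * z"
  proof (rule poly_eqI)
    fix i
    have "n - k - (i - k) = n - i" if "k \<le> i" using that by simp
    then show "coeff (coeff_poly n (\<lambda>i. w (n - i))) i = coeff (t + monom 1 k * z) i"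
      using t(2)[of i] k by (auto simp: coeff_coeff_poly cz w_def L_def coeff_monom_mult)
  qed
  also have "monom 1 k = H - smult q h" using h by simp
  finally have 2: "v - coeff_poly n (\<lambda>i. w (n - i)) - smult q (h * z) = H * (q2 - z)"
    by (simp add: t(1) algebra_simps)
  show thesis
    by (rule that[of w "h * z"])
       (unfold 1 2, simp_all add: G_def H_def null_jet_double_zeros fin)
qed

lemma coeff_poly_add_mult:
  "coeff_poly n (\<lambda>i. w i + c * w' i) = coeff_poly n w + smult c (coeff_poly n w')"
  for c :: "'a::comm_semiring_0"
  by (rule poly_eqI) (simp add: coeff_coeff_poly)

text \<open>Successive approximation: the error q^j r on B is removed by adding q^j times a solution
  for the data 0 on A and r on B. This leaves the jets on A untouched and gains one factor q on
  B.\<close>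

lemma jets_approx_power:
  assumes fin: "finite A" "finite B" and B: "\<And>b. b \<in> B \<Longrightarrow> q dvd b"
    and n: "2 * card A + 2 * card B \<le> Suc n"
  shows "\<exists>w r. null_jet M A (u - coeff_poly n w) \<and>
    null_jet M B (v - coeff_poly n (\<lambda>i. w (n - i)) - smult (q ^ j) r)"
proof (induction j)
  case 0
  obtain w r where "null_jet M A (u - coeff_poly n w)"
    "null_jet M B (v - coeff_poly n (\<lambda>i. w (n - i)) - smult q r)"
    using jets_approx[OF fin B n] .
  then show ?case by (intro exI[of _ w] exI[of _ "smult q r"]) simp
next
  case (Suc j)
  then obtain w r where w: "null_jet M A (u - coeff_poly n w)"
    "null_jet M B (v - coeff_poly n (\<lambda>i. w (n - i)) - smult (q ^ j) r)" by blast
  obtain w' r' where w': "null_jet M A (0 - coeff_poly n w')"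
    "null_jet M B (r - coeff_poly n (\<lambda>i. w' (n - i)) - smult q r')"
    using jets_approx[OF fin B n] .
  define w1 where "w1 = (\<lambda>i. w i + q ^ j * w' i)"
  have 1: "u - coeff_poly n w1 = (u - coeff_poly n w) + smult (q ^ j) (0 - coeff_poly n w')"
    by (simp add: w1_def coeff_poly_add_mult)
  have 2: "v - coeff_poly n (\<lambda>i. w1 (n - i)) - smult (q ^ Suc j) r' =
     (v - coeff_poly n (\<lambda>i. w (n - i)) - smult (q ^ j) r) +
      smult (q ^ j) (r - coeff_poly n (\<lambda>i. w' (n - i)) - smult q r')"
    by (simp add: w1_def coeff_poly_add_mult smult_diff_right mult.commute)
  show ?case
    by (rule exI[of _ w1], rule exI[of _ r'], unfold 1 2)
       (intro conjI null_jet_add null_jet_smult w w')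
qed

text \<open>An error that is a multiple of q^N is invisible modulo q^N, so the jets in the two
  charts can be prescribed independently. The bound compares the number of conditions with n + 1
  free coefficients, which is the origin of 2d - 1 in the first model.\<close>

lemma jets_surj:
  assumes fin: "finite A" "finite B" and B: "\<And>b. b \<in> B \<Longrightarrow> q dvd b"
    and n: "2 * card A + 2 * card B \<le> Suc n"
  obtains w where "null_jet (q ^ N) A (u - coeff_poly n w)"
    "null_jet (q ^ N) B (v - coeff_poly n (\<lambda>i. w (n - i)))"
proof -
  obtain w r where w: "null_jet (q ^ N) A (u - coeff_poly n w)"
    "null_jet (q ^ N) B (v - coeff_poly n (\<lambda>i. w (n - i)) - smult (q ^ N) r)"
    using jets_approx_power[OF fin B n] by blast
  show thesis
    using that[OF w(1)] null_jet_add[OF w(2) null_jet_modulus[of "q ^ N" B r]] by simp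
qed

text \<open>x^n is a multiple of the double zeros plus a multiple of q. Monic polynomials congruent
  to x^n modulo q therefore have the same jets as the multiples of q, a group in which n does not
  occur; the next two lemmas are the two inclusions.\<close>

lemma monom_null_jet:
  assumes fin: "finite A" and A: "\<And>a. a \<in> A \<Longrightarrow> q dvd a" and n: "2 * card A \<le> n"
  obtains h where "null_jet M A (monom 1 n - smult q h)"
proof -
  obtain h where h: "double_zeros A = monom 1 (2 * card A) + smult q h"
    using double_zeros_cong[OF fin A] by blast
  have "monom 1 n = monom 1 (2 * card A) * monom (1::int) (n - 2 * card A)"
    using n by (simp add: mult_monom)
  also have "\<dots> = double_zeros A * monom 1 (n - 2 * card A) - smult q (h * monom 1 (n - 2 * card A))"
    unfolding h by (simp add: algebra_simps)
  finally have "monom 1 n - smult q (- (h * monom 1 (n - 2 * card A)))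
     = double_zeros A * monom 1 (n - 2 * card A)" by simp
  then show thesis using null_jet_double_zeros[OF fin] that by metis
qed

text \<open>The top coefficient is spent on being 1, so 2 card A conditions have to be met by n
  coefficients; hence 2d instead of 2d - 1.\<close>

lemma monic_jets_surj:
  assumes fin: "finite A" and A: "\<And>a. a \<in> A \<Longrightarrow> q dvd a" and n: "2 * card A \<le> n"
  obtains w where "w n = 1" "\<And>i. i < n \<Longrightarrow> q dvd w i"
    "null_jet M A (smult q u - coeff_poly n w)"
proof -
  obtain h where h: "null_jet M A (monom 1 n - smult q h)" using monom_null_jet[OF fin A n] .
  obtain g l where l: "u - h = double_zeros A * g + l" "\<And>i. 2 * card A \<le> i \<Longrightarrow> coeff l i = 0"
    using double_zeros_division[of "u - h" A] by blast
  define w where "w i = (if i < n then q * coeff l i else 1)" for i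
  have "coeff_poly n w = monom 1 n + smult q l"
    by (rule poly_eqI) (use l(2) n in \<open>auto simp: coeff_coeff_poly w_def\<close>)
  then have "smult q u - coeff_poly n w = smult q (u - h - l) - (monom 1 n - smult q h)"
    by (simp add: algebra_simps smult_distribs)
  also have "u - h - l = double_zeros A * g" using l(1) by simp
  finally have "null_jet M A (smult q u - coeff_poly n w)"
    using null_jet_diff[OF null_jet_smult[OF null_jet_double_zeros[OF fin]] h] by simp
  then show thesis using that[of w] by (auto simp: w_def)
qed

lemma monic_jets_range:
  assumes fin: "finite A" and A: "\<And>a. a \<in> A \<Longrightarrow> q dvd a" and n: "2 * card A \<le> n"
    and w: "w n = 1" "\<And>i. i < n \<Longrightarrow> q dvd w i"
  obtains u where "null_jet M A (coeff_poly n w - smult q u)"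
proof -
  obtain h where h: "null_jet M A (monom 1 n - smult q h)" using monom_null_jet[OF fin A n] .
  define l where "l = (\<Sum>i<n. monom (w i div q) i)"
  have "coeff_poly n w = monom 1 n + smult q l"
    by (rule poly_eqI) (use w in \<open>auto simp: coeff_coeff_poly l_def coeff_sum le_less\<close>)
  then have "coeff_poly n w - smult q (h + l) = monom 1 n - smult q h"
    by (simp add: algebra_simps smult_distribs)
  with h show thesis using that by metis
qed

section \<open>Densities of Hensel conditions\<close>

definition jet :: "int \<Rightarrow> int set \<Rightarrow> int poly \<Rightarrow> int \<Rightarrow> int \<times> int" where
  "jet M A u = (\<lambda>a\<in>A. (poly u a mod M, poly (pderiv u) a mod M))"

lemma jet_eq_iff: "jet M A u = jet M A v \<longleftrightarrow> null_jet M A (u - v)"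
proof -
  have "jet M A u = jet M A v \<longleftrightarrow> (\<forall>a\<in>A. jet M A u a = jet M A v a)"
  proof
    assume "\<forall>a\<in>A. jet M A u a = jet M A v a"
    then show "jet M A u = jet M A v" by (auto simp: jet_def restrict_def fun_eq_iff)
  qed simp
  then show ?thesis
    by (simp add: jet_def null_jet_def pderiv_diff mod_eq_dvd_iff)
qed

lemma coeff_poly_diff: "coeff_poly n (\<lambda>i. w i - w' i) = coeff_poly n w - coeff_poly n w'"
  for w :: "nat \<Rightarrow> 'a::ab_group_add"
  by (rule poly_eqI) (simp add: coeff_coeff_poly)

lemma null_jet_coeff_poly:
  assumes "\<And>i. i \<le> n \<Longrightarrow> M dvd x i"
  shows "null_jet M A (coeff_poly n x)"
proof -
  have "coeff_poly n x = smult M (coeff_poly n (\<lambda>i. x i div M))"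
    by (rule poly_eqI) (use assms in \<open>auto simp: coeff_coeff_poly\<close>)
  then show ?thesis using null_jet_modulus by metis
qed

lemma null_jet_cong:
  assumes "\<And>i. i \<le> n \<Longrightarrow> M dvd x i - y i"
  shows "null_jet M A (coeff_poly n x) \<longleftrightarrow> null_jet M A (coeff_poly n y)"
proof -
  have d: "null_jet M A (coeff_poly n x - coeff_poly n y)"
    using null_jet_coeff_poly[of n M "\<lambda>i. x i - y i" A] assms by (simp add: coeff_poly_diff)
  show ?thesis
    using null_jet_diff[OF _ d, of "coeff_poly n x"] null_jet_add[OF d, of "coeff_poly n y"] by auto
qed

definition residues :: "int \<Rightarrow> int \<Rightarrow> int set" where
  "residues M q = {w. 0 \<le> w \<and> w < M \<and> q dvd w}"

text \<open>The default 1 is the leading coefficient in the monic models, where I = {..<n}; for I =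
  {..n} it lies beyond the degree.\<close>

definition fill :: "nat set \<Rightarrow> (nat \<Rightarrow> int) \<Rightarrow> nat \<Rightarrow> int" where
  "fill I c i = (if i \<in> I then c i else 1)"

lemma finite_residues [simp]: "finite (residues M q)"
  by (rule finite_subset[of _ "{0..<M}"]) (auto simp: residues_def)

text \<open>Translation by c2 - c1, reduced modulo M, maps the first fibre injectively into the
  second. The coordinates fixed by \<open>fill\<close> cancel in differences, so the affine family
  of monic polynomials is covered as well as the linear one.\<close>

lemma equal_fibres:
  fixes F :: "(nat \<Rightarrow> int) \<Rightarrow> 'b"
  assumes M: "M > 0" "q dvd M" and I: "finite I"
    and F: "\<And>w w'. F w = F w' \<longleftrightarrow> Nul (\<lambda>i. w i - w' i)"
    and Nul: "\<And>x y. Nul x \<Longrightarrow> (\<And>i. M dvd x i - y i) \<Longrightarrow> Nul y"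
    and c: "c1 \<in> (\<Pi>\<^sub>E i\<in>I. residues M q)" "c2 \<in> (\<Pi>\<^sub>E i\<in>I. residues M q)"
  shows "card {c \<in> \<Pi>\<^sub>E i\<in>I. residues M q. F (fill I c) = F (fill I c1)} \<le>
         card {c \<in> \<Pi>\<^sub>E i\<in>I. residues M q. F (fill I c) = F (fill I c2)}"
proof (rule card_inj_on_le)
  let ?X = "\<Pi>\<^sub>E i\<in>I. residues M q"
  let ?t = "\<lambda>c. \<lambda>i\<in>I. (c i + c2 i - c1 i) mod M"
  show "finite {c \<in> ?X. F (fill I c) = F (fill I c2)}"
    by (rule finite_subset[of _ ?X]) (auto intro!: finite_PiE I)
  show "inj_on ?t {c \<in> ?X. F (fill I c) = F (fill I c1)}"
  proof (rule inj_onI)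
    fix a b assume a: "a \<in> {c \<in> ?X. F (fill I c) = F (fill I c1)}"
      and b: "b \<in> {c \<in> ?X. F (fill I c) = F (fill I c1)}" and eq: "?t a = ?t b"
    have "a \<in> ?X" "b \<in> ?X" using a b by blast+
    then show "a = b"
    proof (rule PiE_ext)
      fix i assume i: "i \<in> I"
      have "?t a i = ?t b i" using eq by simp
      then have "M dvd (a i + c2 i - c1 i) - (b i + c2 i - c1 i)"
        using i by (simp only: restrict_apply' mod_eq_dvd_iff)
      then have "M dvd a i - b i" by simp
      moreover have "0 \<le> a i" "a i < M" "0 \<le> b i" "b i < M"
        using a b i by (auto simp: PiE_iff residues_def)
      ultimately show "a i = b i" by (metis mod_eq_dvd_iff mod_pos_pos_trivial)
    qed
  qed
  show "?t ` {c \<in> ?X. F (fill I c) = F (fill I c1)} \<subseteq> {c \<in> ?X. F (fill I c) = F (fill I c2)}"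
  proof (rule image_subsetI, rule CollectI, rule conjI)
    fix a assume "a \<in> {c \<in> ?X. F (fill I c) = F (fill I c1)}"
    then have a: "a \<in> ?X" and Fa: "F (fill I a) = F (fill I c1)" by blast+
    show "?t a \<in> ?X"
    proof (rule restrict_PiE_iff[THEN iffD2], rule)
      fix i assume i: "i \<in> I"
      then have "q dvd a i + c2 i - c1 i" using a c by (auto simp: PiE_iff residues_def)
      then show "(a i + c2 i - c1 i) mod M \<in> residues M q"
        using M by (simp add: residues_def dvd_mod)
    qed
    have "Nul (\<lambda>i. fill I a i - fill I c1 i)" using Fa F by simp
    then have "Nul (\<lambda>i. fill I (?t a) i - fill I c2 i)"
    proof (rule Nul)
      fix i
      show "M dvd fill I a i - fill I c1 i - (fill I (?t a) i - fill I c2 i)"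
      proof (cases "i \<in> I")
        case True
        have "M dvd (a i + c2 i - c1 i) - (a i + c2 i - c1 i) mod M"
          by (simp add: minus_mod_eq_mult_div)
        then show ?thesis using True by (simp add: fill_def algebra_simps)
      qed (simp add: fill_def)
    qed
    then show "F (fill I (?t a)) = F (fill I c2)" using F by simp
  qed
qed

text \<open>When all fibres have the same size, F carries the uniform distribution on X to the
  uniform distribution on its image, so proportions can be computed in the image.\<close>

lemma card_equal_fibres:
  assumes fin: "finite X"
    and le: "\<And>x y. x \<in> X \<Longrightarrow> y \<in> X \<Longrightarrow> card {z \<in> X. F z = F x} \<le> card {z \<in> X. F z = F y}"
  shows "real (card {x \<in> X. P (F x)}) / real (card X) = real (card {y \<in> F ` X. P y}) / real (card (F ` X))"
proof (cases "X = {}")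
  case False
  then obtain x0 where x0: "x0 \<in> X" by blast
  define k where "k = card {z \<in> X. F z = F x0}"
  have k: "card {z \<in> X. F z = y} = k" if "y \<in> F ` X" for y
    using that le x0 unfolding k_def by (auto intro: antisym)
  have "{z \<in> X. F z = F x0} \<noteq> {}" using x0 by auto
  then have k0: "k > 0" using fin by (simp add: k_def card_gt_0_iff)
  have *: "card {x \<in> X. P (F x)} = card {y \<in> F ` X. P y} * k" for P
  proof -
    have "card {x \<in> X. P (F x)} = (\<Sum>y\<in>{y \<in> F ` X. P y}. card {x \<in> {x \<in> X. P (F x)}. F x = y})"
      using sum.group[of "{x \<in> X. P (F x)}" "{y \<in> F ` X. P y}" F "\<lambda>_. 1::nat"] fin
      by (simp add: image_subset_iff)
    also have "\<dots> = (\<Sum>y\<in>{y \<in> F ` X. P y}. k)"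
    proof (rule sum.cong)
      fix y assume y: "y \<in> {y \<in> F ` X. P y}"
      then have "{x \<in> {x \<in> X. P (F x)}. F x = y} = {x \<in> X. F x = y}" by auto
      then show "card {x \<in> {x \<in> X. P (F x)}. F x = y} = k" using k[of y] y by simp
    qed simp
    finally show ?thesis by simp
  qed
  have "{y \<in> F ` X. True} = F ` X" "{x \<in> X. True} = X" by auto
  then have "card X = card (F ` X) * k" using *[of "\<lambda>_. True"] by simp
  then show ?thesis using k0 *[of P] by simp
qed simp

text \<open>For a set S of labels this is the Haar probability that S consists of Hensel labels, see
  \<open>prob_hensel_density\<close>; e is the number of lowest digits forced to be 0.\<close>

definition hensel_density :: "nat \<Rightarrow> nat \<Rightarrow> nat \<Rightarrow> nat set \<Rightarrow> nat \<Rightarrow> (nat \<times> nat) set \<Rightarrow> real" where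
  "hensel_density p k e I n S =
     real (card {c \<in> \<Pi>\<^sub>E i\<in>I. residues (int p ^ (2 * k)) (int p ^ e).
        \<forall>s\<in>S. hensel_class p k (scaled_poly p n (fst s) (fill I c)) (int (snd s))}) /
     real (card (\<Pi>\<^sub>E i\<in>I. residues (int p ^ (2 * k)) (int p ^ e)))"

lemma hensel_density_eq:
  fixes F :: "(nat \<Rightarrow> int) \<Rightarrow> 'b"
  assumes p: "p > 0" "e \<le> 2 * k" and I: "finite I"
    and F: "\<And>w w'. F w = F w' \<longleftrightarrow> Nul (\<lambda>i. w i - w' i)"
    and Nul: "\<And>x y. Nul x \<Longrightarrow> (\<And>i. int p ^ (2 * k) dvd x i - y i) \<Longrightarrow> Nul y"
    and P: "\<And>w. (\<forall>s\<in>S. hensel_class p k (scaled_poly p n (fst s) w) (int (snd s))) \<longleftrightarrow> P (F w)"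
    and Q: "Q = (\<lambda>c. F (fill I c)) ` (\<Pi>\<^sub>E i\<in>I. residues (int p ^ (2 * k)) (int p ^ e))"
  shows "hensel_density p k e I n S = real (card {y \<in> Q. P y}) / real (card Q)"
  unfolding hensel_density_def P Q
proof (rule card_equal_fibres)
  show "finite (\<Pi>\<^sub>E i\<in>I. residues (int p ^ (2 * k)) (int p ^ e))"
    using I by (simp add: finite_PiE)
qed (rule equal_fibres[where F = F and Nul = Nul, OF _ _ I F Nul], use p in \<open>auto simp: le_imp_power_dvd\<close>)

text \<open>The substitution f(a/p^m) = (a/p^m)^n g(p^m/a), where g is the reversed polynomial, and its derivative.\<close>

lemma hensel_class_chart:
  assumes p: "prime p" and cop: "\<not> p dvd a" and inv: "int p ^ (2 * k) dvd int a * a' - 1"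
    and b: "b = int p ^ m * a'"
  shows "hensel_class p k (scaled_poly p n m w) (int a) \<longleftrightarrow>
    hensel_pair p k (poly (coeff_poly n (\<lambda>i. w (n - i))) b)
      (b * poly (pderiv (coeff_poly n (\<lambda>i. w (n - i)))) b)"
proof -
  define A where "A = int a"
  define M where "M = int p ^ (2 * k)"
  define x where "x = poly (scaled_poly p n m w) A"
  define y where "y = poly (pderiv (scaled_poly p n m w)) A"
  define x' where "x' = poly (coeff_poly n (\<lambda>i. w (n - i))) b"
  define y' where "y' = b * poly (pderiv (coeff_poly n (\<lambda>i. w (n - i)))) b"
  \<comment> \<open>b is p^m / A modulo M, so multiplication by A^n clears the denominators.\<close>
  have t: "[A ^ n * b ^ (n - i) = A ^ i * int p ^ (m * (n - i))] (mod M)" if "i \<le> n" for i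
  proof -
    have "A ^ n * b ^ (n - i) = A ^ i * int p ^ (m * (n - i)) * (A * a') ^ (n - i)"
      using that by (simp add: b power_mult_distrib power_mult power_add[symmetric] mult_ac)
    also have "[\<dots> = A ^ i * int p ^ (m * (n - i)) * 1 ^ (n - i)] (mod M)"
      using inv by (intro cong_mult cong_refl cong_pow) (simp add: cong_iff_dvd_diff A_def M_def)
    finally show ?thesis by simp
  qed
  have x'_eq: "x' = (\<Sum>i\<le>n. w i * b ^ (n - i))"
    unfolding x'_def poly_coeff_poly
    by (rule sum.reindex_bij_witness[of _ "\<lambda>i. n - i" "\<lambda>i. n - i"]) auto
  have "coeff_poly n (\<lambda>i. w (n - i)) = scaled_poly p n 0 (\<lambda>i. w (n - i))"
    by (simp add: scaled_poly_0)
  then have "y' = (\<Sum>i\<le>n. b * (of_nat i * w (n - i) * b ^ (i - 1)))"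
    by (simp add: y'_def poly_pderiv_scaled_poly sum_distrib_left)
  also have "\<dots> = (\<Sum>i\<le>n. of_nat (n - i) * w i * b ^ (n - i))"
  proof (rule sum.reindex_bij_witness[of _ "\<lambda>i. n - i" "\<lambda>i. n - i"])
    fix i assume "i \<in> {..n}"
    then show "int (n - (n - i)) * w (n - i) * b ^ (n - (n - i)) = b * (int i * w (n - i) * b ^ (i - 1))"
      by (cases i) auto
  qed auto
  finally have y'_eq: "y' = (\<Sum>i\<le>n. of_nat (n - i) * w i * b ^ (n - i))" .
  have "[(\<Sum>i\<le>n. w i * (A ^ n * b ^ (n - i))) = (\<Sum>i\<le>n. w i * (A ^ i * int p ^ (m * (n - i))))] (mod M)"
    by (intro cong_sum cong_mult cong_refl t) auto
  then have xx: "[A ^ n * x' = x] (mod M)"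
    by (simp add: x'_eq x_def poly_scaled_poly sum_distrib_left mult_ac)
  have "[(\<Sum>i\<le>n. of_nat (n - i) * w i * (A ^ n * b ^ (n - i))) =
      (\<Sum>i\<le>n. of_nat (n - i) * w i * (A ^ i * int p ^ (m * (n - i))))] (mod M)"
    by (intro cong_sum cong_mult cong_refl t) auto
  then have "[A ^ n * y' = (\<Sum>i\<le>n. of_nat (n - i) * w i * (A ^ i * int p ^ (m * (n - i))))] (mod M)"
    by (simp add: y'_eq sum_distrib_left mult_ac)
  \<comment> \<open>Euler's relation n F = X F_X + Z F_Z for the homogenised polynomial, at X = A
    and Z = p^m.\<close>
  moreover have "(\<Sum>i\<le>n. of_nat (n - i) * w i * (A ^ i * int p ^ (m * (n - i)))) = int n * x - A * y"
    unfolding x_def y_def poly_scaled_poly poly_pderiv_scaled_poly sum_distrib_left sum_subtractf[symmetric]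
  proof (rule sum.cong)
    fix i assume "i \<in> {..n}"
    then show "int (n - i) * w i * (A ^ i * int p ^ (m * (n - i))) =
       int n * (w i * int p ^ (m * (n - i)) * A ^ i) -
         A * (int i * (w i * int p ^ (m * (n - i))) * A ^ (i - 1))"
      by (cases i) (auto simp: of_nat_diff algebra_simps)
  qed simp
  ultimately have yy: "M dvd A ^ n * y' - (int n * x - A * y)"
    by (simp add: cong_iff_dvd_diff)
  have copA: "coprime (int p ^ j) A" "coprime (int p ^ j) (A ^ n)" for j
    using p cop by (auto simp: A_def intro!: prime_imp_coprime)
  have eqx: "int p ^ j dvd x \<longleftrightarrow> int p ^ j dvd x'" if "j \<le> 2 * k" for j
  proof -
    have "int p ^ j dvd A ^ n * x' - x"
      using xx that unfolding cong_iff_dvd_diff M_def by (meson dvd_trans le_imp_power_dvd)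
    then have "int p ^ j dvd x \<longleftrightarrow> int p ^ j dvd A ^ n * x'"
      by (metis dvd_diff_left_iff dvd_diff_right_iff)
    then show ?thesis using copA(2) by (simp add: coprime_dvd_mult_right_iff)
  qed
  \<comment> \<open>The derivatives in the two charts agree up to a unit factor only where the term
    n x is negligible. This suffices, because the Hensel condition makes x divisible by p^(k +
    \<mu>), hence by p^(\<mu> + 1).\<close>
  have eqy: "int p ^ j dvd y \<longleftrightarrow> int p ^ j dvd y'" if "j \<le> 2 * k" "int p ^ j dvd x" for j
  proof -
    have "int p ^ j dvd A ^ n * y' - (int n * x - A * y)"
      using yy that(1) unfolding M_def by (meson dvd_trans le_imp_power_dvd)
    moreover have "int p ^ j dvd int n * x" using that(2) by simp
    ultimately have "int p ^ j dvd (A ^ n * y' - (int n * x - A * y)) + int n * x"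
      by (rule dvd_add)
    then have "int p ^ j dvd A ^ n * y' + A * y" by simp
    then have "int p ^ j dvd A * y \<longleftrightarrow> int p ^ j dvd A ^ n * y'"
      by (metis dvd_add_right_iff dvd_add_left_iff)
    then show ?thesis using copA by (simp add: coprime_dvd_mult_right_iff)
  qed
  have "hensel_pair p k x y \<longleftrightarrow> hensel_pair p k x' y'"
    unfolding hensel_pair_def
  proof (intro iff_exI)
    fix \<mu>
    show "(\<mu> < k \<and> int p ^ \<mu> dvd y \<and> \<not> int p ^ Suc \<mu> dvd y \<and> int p ^ (k + \<mu>) dvd x) \<longleftrightarrow>
       (\<mu> < k \<and> int p ^ \<mu> dvd y' \<and> \<not> int p ^ Suc \<mu> dvd y' \<and> int p ^ (k + \<mu>) dvd x')"
    proof (cases "\<mu> < k \<and> int p ^ (k + \<mu>) dvd x")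
      case True
      then have "int p ^ \<mu> dvd x" "int p ^ Suc \<mu> dvd x"
        by (meson dvd_trans le_imp_power_dvd le_add2, 
          metis (no_types, lifting) dvd_trans le_imp_power_dvd Suc_leI trans_le_add1)
      with True show ?thesis using eqx[of "k + \<mu>"] eqy[of \<mu>] eqy[of "Suc \<mu>"] by auto
    next
      case False
      then show ?thesis using eqx[of "k + \<mu>"] by auto
    qed
  qed
  then show ?thesis by (simp add: hensel_class_def x_def y_def x'_def y'_def A_def)
qed

text \<open>Roots u / p^m with m > 0 are seen in the chart at infinity, at the point p^m / u.\<close>

definition hensel_jet :: "int \<Rightarrow> nat \<Rightarrow> int set \<Rightarrow> int set \<Rightarrow> (nat \<Rightarrow> int) \<Rightarrow>
    (int \<Rightarrow> int \<times> int) \<times> (int \<Rightarrow> int \<times> int)" where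
  "hensel_jet M n A B w = (jet M A (coeff_poly n w), jet M B (coeff_poly n (\<lambda>i. w (n - i))))"

definition null_coeffs :: "int \<Rightarrow> nat \<Rightarrow> int set \<Rightarrow> int set \<Rightarrow> (nat \<Rightarrow> int) \<Rightarrow> bool" where
  "null_coeffs M n A B x \<longleftrightarrow>
     null_jet M A (coeff_poly n x) \<and> null_jet M B (coeff_poly n (\<lambda>i. x (n - i)))"

lemma hensel_jet_eq_iff:
  "hensel_jet M n A B w = hensel_jet M n A B w' \<longleftrightarrow> null_coeffs M n A B (\<lambda>i. w i - w' i)"
  by (simp add: hensel_jet_def null_coeffs_def jet_eq_iff coeff_poly_diff)

lemma null_coeffs_cong:
  assumes "\<And>i. i \<le> n \<Longrightarrow> M dvd x i - y i"
  shows "null_coeffs M n A B x \<longleftrightarrow> null_coeffs M n A B y"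
  unfolding null_coeffs_def
  using null_jet_cong[of n M x y A] null_jet_cong[of n M "\<lambda>i. x (n - i)" "\<lambda>i. y (n - i)" B] assms
  by simp

lemma hensel_jet_cong:
  assumes "\<And>i. i \<le> n \<Longrightarrow> M dvd w i - w' i"
  shows "hensel_jet M n A B w = hensel_jet M n A B w'"
  unfolding hensel_jet_eq_iff
  using null_coeffs_cong[of n M "\<lambda>i. w i - w' i" "\<lambda>_. 0" A B] assms
  by (simp add: null_coeffs_def null_jet_coeff_poly)

definition modular_inverse :: "int \<Rightarrow> nat \<Rightarrow> int" where
  "modular_inverse M a = (SOME b. M dvd int a * b - 1)"

text \<open>The point p^m / a at infinity for the label (m, a), with 1 / a computed modulo
  p^(2k).\<close>

definition chart_point :: "nat \<Rightarrow> nat \<Rightarrow> nat \<times> nat \<Rightarrow> int" where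
  "chart_point p k s = int p ^ fst s * modular_inverse (int p ^ (2 * k)) (snd s)"

definition affine_points :: "(nat \<times> nat) set \<Rightarrow> int set" where
  "affine_points S = (\<lambda>s. int (snd s)) ` {s \<in> S. fst s = 0}"

definition infinite_points :: "nat \<Rightarrow> nat \<Rightarrow> (nat \<times> nat) set \<Rightarrow> int set" where
  "infinite_points p k S = chart_point p k ` {s \<in> S. fst s \<noteq> 0}"

text \<open>The Hensel conditions expressed by jets, without n: the degree can now influence a
  density only through the set of jets that are attained.\<close>

definition hensel_jets :: "nat \<Rightarrow> nat \<Rightarrow> (nat \<times> nat) set \<Rightarrow>
    (int \<Rightarrow> int \<times> int) \<times> (int \<Rightarrow> int \<times> int) \<Rightarrow> bool" where
  "hensel_jets p k S q \<longleftrightarrow> (\<forall>s\<in>S.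
     if fst s = 0 then hensel_pair p k (fst (fst q (int (snd s)))) (snd (fst q (int (snd s))))
     else hensel_pair p k (fst (snd q (chart_point p k s)))
            (chart_point p k s * snd (snd q (chart_point p k s))))"

lemma card_points_le:
  assumes "finite S"
  shows "card (affine_points S) + card (infinite_points p k S) \<le> card S"
proof -
  have "card (affine_points S) + card (infinite_points p k S)
      \<le> card {s \<in> S. fst s = 0} + card {s \<in> S. fst s \<noteq> 0}"
    unfolding affine_points_def infinite_points_def
    by (intro add_mono card_image_le) (use assms in auto)
  also have "\<dots> = card ({s \<in> S. fst s = 0} \<union> {s \<in> S. fst s \<noteq> 0})"
    by (rule card_Un_disjoint[symmetric]) (use assms in auto)
  also have "{s \<in> S. fst s = 0} \<union> {s \<in> S. fst s \<noteq> 0} = S" by blast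
  finally show ?thesis .
qed

lemma modular_inverse:
  assumes "prime p" "\<not> p dvd a"
  shows "int p ^ N dvd int a * modular_inverse (int p ^ N) a - 1"
proof -
  have "coprime (int p ^ N) (int a)"
    using assms by (auto intro!: prime_imp_coprime)
  then have "coprime (int a) (int p ^ N)" by (simp add: coprime_commute)
  then obtain b where "[int a * b = 1] (mod int p ^ N)" using cong_solve_coprime_int by blast
  then have "\<exists>b. int p ^ N dvd int a * b - 1" by (auto simp: cong_iff_dvd_diff)
  then show ?thesis unfolding modular_inverse_def by (rule someI_ex)
qed

lemma hensel_pair_mod:
  "hensel_pair p k (x mod int p ^ (2 * k)) (c * (y mod int p ^ (2 * k))) \<longleftrightarrow> hensel_pair p k x (c * y)"
proof (rule hensel_pair_cong)
  have d: "int p ^ (2 * k) dvd x mod int p ^ (2 * k) - x" for x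
    by (metis mod_eq_dvd_iff mod_mod_trivial)
  show "int p ^ (2 * k) dvd x mod int p ^ (2 * k) - x" by (rule d)
  have "int p ^ k dvd int p ^ (2 * k)" by (simp add: le_imp_power_dvd)
  then have "int p ^ k dvd c * (y mod int p ^ (2 * k) - y)"
    using d by (meson dvd_trans dvd_mult)
  then show "int p ^ k dvd c * (y mod int p ^ (2 * k)) - c * y"
    by (simp add: algebra_simps)
qed

lemma hensel_jets_iff:
  assumes p: "prime p" and S: "S \<subseteq> labels p k"
  shows "(\<forall>s\<in>S. hensel_class p k (scaled_poly p n (fst s) w) (int (snd s))) \<longleftrightarrow>
    hensel_jets p k S (hensel_jet (int p ^ (2 * k)) n (affine_points S) (infinite_points p k S) w)"
  unfolding hensel_jets_def
proof (rule ball_cong)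
  fix s assume s: "s \<in> S"
  let ?M = "int p ^ (2 * k)"
  show "hensel_class p k (scaled_poly p n (fst s) w) (int (snd s)) \<longleftrightarrow>
    (if fst s = 0 then
       hensel_pair p k (fst (fst (hensel_jet ?M n (affine_points S) (infinite_points p k S) w) (int (snd s))))
         (snd (fst (hensel_jet ?M n (affine_points S) (infinite_points p k S) w) (int (snd s))))
     else hensel_pair p k (fst (snd (hensel_jet ?M n (affine_points S) (infinite_points p k S) w) (chart_point p k s)))
            (chart_point p k s * snd (snd (hensel_jet ?M n (affine_points S) (infinite_points p k S) w) (chart_point p k s))))"
  proof (cases "fst s = 0")
    case True
    have "int (snd s) \<in> affine_points S" using s True by (auto simp: affine_points_def)
    then show ?thesis
      using hensel_pair_mod[of p k "poly (coeff_poly n w) (int (snd s))" 1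
          "poly (pderiv (coeff_poly n w)) (int (snd s))"] True
      by (simp add: hensel_class_def scaled_poly_0 hensel_jet_def jet_def)
  next
    case False
    have "chart_point p k s \<in> infinite_points p k S" using s False by (auto simp: infinite_points_def)
    moreover have nd: "\<not> p dvd snd s" using s S False by (auto simp: labels_def)
    ultimately show ?thesis
      using hensel_class_chart[OF p nd modular_inverse[OF p nd] chart_point_def] False
      by (simp add: hensel_jet_def jet_def hensel_pair_mod)
  qed
qed simp

text \<open>Reduces the comparison of two degrees to showing that they have the same image
  Q.\<close>

lemma hensel_density_eq_image:
  assumes p: "prime p" and e: "e \<le> 2 * k" and I: "finite I" and S: "S \<subseteq> labels p k"
    and Q: "Q = (\<lambda>c. hensel_jet (int p ^ (2 * k)) n (affine_points S) (infinite_points p k S) (fill I c)) `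
       (\<Pi>\<^sub>E i\<in>I. residues (int p ^ (2 * k)) (int p ^ e))"
  shows "hensel_density p k e I n S = real (card {y \<in> Q. hensel_jets p k S y}) / real (card Q)"
proof (rule hensel_density_eq[OF _ e I hensel_jet_eq_iff _ hensel_jets_iff[OF p S] Q])
  show "p > 0" using p by (simp add: prime_gt_0_nat)
  show "null_coeffs (int p ^ (2 * k)) n (affine_points S) (infinite_points p k S) y"
    if "null_coeffs (int p ^ (2 * k)) n (affine_points S) (infinite_points p k S) x"
      "\<And>i. int p ^ (2 * k) dvd x i - y i" for x y
    using that null_coeffs_cong[of n "int p ^ (2 * k)" x y] by blast
qed

lemma hensel_density_degree_indep:
  assumes p: "prime p" and S: "S \<subseteq> labels p k"
    and n: "2 * card S \<le> Suc n" "2 * card S \<le> Suc n'"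
  shows "hensel_density p k 0 {..n} n S = hensel_density p k 0 {..n'} n' S"
proof -
  let ?M = "int p ^ (2 * k)" and ?A = "affine_points S" and ?B = "infinite_points p k S"
  have finS: "finite S" using S by (rule finite_subset) simp
  have fin: "finite ?A" "finite ?B" using finS by (auto simp: affine_points_def infinite_points_def)
  have B: "int p dvd b" if "b \<in> ?B" for b
    using that by (auto simp: infinite_points_def chart_point_def dvd_power)
  have M: "?M > 0" using p by (simp add: prime_gt_0_nat)
  \<comment> \<open>All pairs of jets of integer polynomials, of any degree. Points congruent modulo
    p have congruent values, so R can be smaller than the set of all functions.\<close>
  define R where "R = range (\<lambda>(u, v). (jet ?M ?A u, jet ?M ?B v))"
  have im: "(\<lambda>c. hensel_jet ?M n ?A ?B (fill {..n} c)) ` (\<Pi>\<^sub>E i\<in>{..n}. residues ?M (int p ^ 0)) = R"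
    if n: "2 * card S \<le> Suc n" for n
  proof
    show "(\<lambda>c. hensel_jet ?M n ?A ?B (fill {..n} c)) ` (\<Pi>\<^sub>E i\<in>{..n}. residues ?M (int p ^ 0)) \<subseteq> R"
      by (auto simp: R_def hensel_jet_def)
    show "R \<subseteq> (\<lambda>c. hensel_jet ?M n ?A ?B (fill {..n} c)) ` (\<Pi>\<^sub>E i\<in>{..n}. residues ?M (int p ^ 0))"
    proof
      fix y assume "y \<in> R"
      then obtain u v where y: "y = (jet ?M ?A u, jet ?M ?B v)" by (auto simp: R_def)
      have "2 * card ?A + 2 * card ?B \<le> Suc n"
        using n card_points_le[OF finS, of p k] by linarith
      then obtain w where w: "null_jet ?M ?A (u - coeff_poly n w)"
          "null_jet ?M ?B (v - coeff_poly n (\<lambda>i. w (n - i)))"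
        using jets_surj[OF fin B] by metis
      define c where "c = (\<lambda>i\<in>{..n}. w i mod ?M)"
      have "c \<in> (\<Pi>\<^sub>E i\<in>{..n}. residues ?M (int p ^ 0))"
        using M by (auto simp: c_def residues_def)
      moreover have "y = hensel_jet ?M n ?A ?B w"
        using w by (simp add: y hensel_jet_def jet_eq_iff)
      moreover have "hensel_jet ?M n ?A ?B w = hensel_jet ?M n ?A ?B (fill {..n} c)"
        by (rule hensel_jet_cong) (simp add: fill_def c_def minus_mod_eq_mult_div)
      ultimately show "y \<in> (\<lambda>c. hensel_jet ?M n ?A ?B (fill {..n} c)) ` (\<Pi>\<^sub>E i\<in>{..n}. residues ?M (int p ^ 0))"
        by auto
    qed
  qed
  show ?thesis
    unfolding hensel_density_eq_image[OF p _ _ S im[OF n(1), symmetric], simplified]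
      hensel_density_eq_image[OF p _ _ S im[OF n(2), symmetric], simplified] ..
qed

text \<open>All terms but the leading one are divisible by p, and the leading one is a unit. This
  rules out denominators for monic polynomials and unit roots for those that reduce to x^n.\<close>

lemma monic_not_dvd:
  assumes p: "prime p" and w: "w n = 1" "\<And>i. i < n \<Longrightarrow> int p dvd w i * int p ^ (m * (n - i))"
    and a: "\<not> p dvd a"
  shows "\<not> int p dvd poly (scaled_poly p n m w) (int a)"
proof
  assume "int p dvd poly (scaled_poly p n m w) (int a)"
  moreover have "poly (scaled_poly p n m w) (int a) =
      (\<Sum>i<n. w i * int p ^ (m * (n - i)) * int a ^ i) + int a ^ n"
    using w(1) by (simp add: poly_scaled_poly flip: lessThan_Suc_atMost)
  moreover have "int p dvd (\<Sum>i<n. w i * int p ^ (m * (n - i)) * int a ^ i)"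
    using w(2) by (intro dvd_sum) (simp add: dvd_mult2)
  ultimately have "int p dvd int a ^ n" by (simp add: dvd_add_right_iff)
  then have "p dvd a ^ n" by (simp flip: of_nat_power)
  then show False using p a prime_dvd_power by blast
qed

lemma hensel_class_imp_dvd:
  assumes "hensel_class p k f a"
  shows "int p dvd poly f a"
proof -
  obtain \<mu> where \<mu>: "\<mu> < k" "int p ^ (k + \<mu>) dvd poly f a"
    using assms by (auto simp: hensel_class_def hensel_pair_def)
  then show ?thesis by (cases k) (auto dest: dvd_mult_left)
qed

lemma hensel_density_monic_degree_indep:
  assumes p: "prime p" and S: "S \<subseteq> labels p k" and e: "e \<le> 1"
    and n: "2 * card S \<le> n" "2 * card S \<le> n'"
  shows "hensel_density p k e {..<n} n S = hensel_density p k e {..<n'} n' S"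
proof (cases "\<forall>s\<in>S. fst s = 0 \<and> p ^ e dvd snd s")
  case False
  then obtain s where s: "s \<in> S" "fst s \<noteq> 0 \<or> \<not> p ^ e dvd snd s" by blast
  \<comment> \<open>A label outside the remaining case has a numerator prime to p: by reducedness if
    m > 0, and otherwise because e = 1. Such a label is never a Hensel label, so both densities are
    0.\<close>
  have nd: "\<not> p dvd snd s"
    using s S e by (cases e) (auto simp: labels_def)
  have "hensel_density p k e {..<n} n S = 0" for n
  proof -
    have "\<not> hensel_class p k (scaled_poly p n (fst s) (fill {..<n} c)) (int (snd s))"
      if c: "c \<in> (\<Pi>\<^sub>E i\<in>{..<n}. residues (int p ^ (2 * k)) (int p ^ e))" for c
    proof (rule contrapos_nn[OF monic_not_dvd[OF p _ _ nd] hensel_class_imp_dvd])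
      fix i assume i: "i < n"
      show "int p dvd fill {..<n} c i * int p ^ (fst s * (n - i))"
      proof (cases "fst s = 0")
        case True
        then have "e = 1" using s(2) e by (cases e) auto
        then have "int p dvd c i" using c i by (auto simp: PiE_iff residues_def)
        then show ?thesis using i by (simp add: fill_def)
      next
        case False
        then show ?thesis using i by (intro dvd_mult dvd_power) auto
      qed
    qed (simp add: fill_def)
    then have "{c \<in> \<Pi>\<^sub>E i\<in>{..<n}. residues (int p ^ (2 * k)) (int p ^ e).
        \<forall>s\<in>S. hensel_class p k (scaled_poly p n (fst s) (fill {..<n} c)) (int (snd s))} = {}"
      using s(1) by blast
    note empty = this
    show ?thesis unfolding hensel_density_def empty by simp
  qed
  then show ?thesis by simp
next
  case True
  show ?thesis
  \<comment> \<open>Level 0 is treated directly because the residues p^e modulo p^(2k) require e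
    \<le> 2k.\<close>
  proof (cases "k = 0")
    case True
    then have "S = {}" using S by simp
    moreover have "residues 1 (int p ^ e) = {0}" by (auto simp: residues_def)
    ultimately show ?thesis
      by (simp add: hensel_density_def \<open>k = 0\<close> card_PiE)
  next
    case False
    let ?M = "int p ^ (2 * k)" and ?A = "affine_points S" and ?B = "infinite_points p k S"
    have finS: "finite S" using S by (rule finite_subset) simp
    have fin: "finite ?A" using finS by (auto simp: affine_points_def)
    have B: "?B = {}" using True by (auto simp: infinite_points_def)
    have A: "int p ^ e dvd a" if "a \<in> ?A" for a
      using that True by (auto simp: affine_points_def simp flip: of_nat_power)
    have M: "?M > 0" using p by (simp add: prime_gt_0_nat)
    have ek: "e \<le> 2 * k" using e False by linarith
    then have qM: "int p ^ e dvd ?M" by (rule le_imp_power_dvd)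
    \<comment> \<open>Jets of arbitrary multiples of p^e. The second component is constant because
      no points at infinity remain.\<close>
    define R where "R = range (\<lambda>u. (jet ?M ?A (smult (int p ^ e) u), jet ?M ?B 0))"
    have jB: "jet ?M ?B v = jet ?M ?B 0" for v by (simp add: jet_def B restrict_def)
    have im: "(\<lambda>c. hensel_jet ?M n ?A ?B (fill {..<n} c)) ` (\<Pi>\<^sub>E i\<in>{..<n}. residues ?M (int p ^ e)) = R"
      if n: "2 * card S \<le> n" for n
    proof
      have cA: "2 * card ?A \<le> n"
        using n card_points_le[OF finS, of p k] by linarith
      show "(\<lambda>c. hensel_jet ?M n ?A ?B (fill {..<n} c)) ` (\<Pi>\<^sub>E i\<in>{..<n}. residues ?M (int p ^ e)) \<subseteq> R"
      proof (rule image_subsetI)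
        fix c assume c: "c \<in> (\<Pi>\<^sub>E i\<in>{..<n}. residues ?M (int p ^ e))"
        have "fill {..<n} c n = 1" "\<And>i. i < n \<Longrightarrow> int p ^ e dvd fill {..<n} c i"
          using c by (auto simp: fill_def PiE_iff residues_def)
        then obtain u where "null_jet ?M ?A (coeff_poly n (fill {..<n} c) - smult (int p ^ e) u)"
          using monic_jets_range[OF fin A cA] by metis
        then have "hensel_jet ?M n ?A ?B (fill {..<n} c) = (jet ?M ?A (smult (int p ^ e) u), jet ?M ?B 0)"
          using jB by (simp add: hensel_jet_def jet_eq_iff[of ?M ?A])
        then show "hensel_jet ?M n ?A ?B (fill {..<n} c) \<in> R" by (auto simp: R_def)
      qed
      show "R \<subseteq> (\<lambda>c. hensel_jet ?M n ?A ?B (fill {..<n} c)) ` (\<Pi>\<^sub>E i\<in>{..<n}. residues ?M (int p ^ e))"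
      proof
        fix y assume "y \<in> R"
        then obtain u where y: "y = (jet ?M ?A (smult (int p ^ e) u), jet ?M ?B 0)" by (auto simp: R_def)
        obtain w where w: "w n = 1" "\<And>i. i < n \<Longrightarrow> int p ^ e dvd w i"
            "null_jet ?M ?A (smult (int p ^ e) u - coeff_poly n w)"
          using monic_jets_surj[OF fin A cA] by metis
        define c where "c = (\<lambda>i\<in>{..<n}. w i mod ?M)"
        have "c \<in> (\<Pi>\<^sub>E i\<in>{..<n}. residues ?M (int p ^ e))"
          using M w(2) qM by (auto simp: c_def residues_def dvd_mod)
        moreover have "y = hensel_jet ?M n ?A ?B w"
          using w(3) jB[of "coeff_poly n (\<lambda>i. w (n - i))"]
          by (simp add: y hensel_jet_def jet_eq_iff[of ?M ?A])
        moreover have "hensel_jet ?M n ?A ?B w = hensel_jet ?M n ?A ?B (fill {..<n} c)"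
          by (rule hensel_jet_cong)
             (use w(1) in \<open>auto simp: fill_def c_def minus_mod_eq_mult_div\<close>)
        ultimately show "y \<in> (\<lambda>c. hensel_jet ?M n ?A ?B (fill {..<n} c)) ` (\<Pi>\<^sub>E i\<in>{..<n}. residues ?M (int p ^ e))"
          by auto
      qed
    qed
    show ?thesis
      unfolding hensel_density_eq_image[OF p ek finite_lessThan S im[OF n(1), symmetric]]
        hensel_density_eq_image[OF p ek finite_lessThan S im[OF n(2), symmetric]] ..
  qed
qed

section \<open>Uniform residues under Haar measure\<close>

lemma measurable_zp_haar_component:
  assumes "x \<in> I \<times> UNIV"
  shows "(\<lambda>\<omega>. \<omega> x) \<in> measurable (zp_haar p I) (count_space UNIV)"
proof -
  have "(\<lambda>\<omega>. \<omega> x) \<in> measurable (zp_haar p I) (measure_pmf (pmf_of_set {..<p}))"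
    unfolding zp_haar_def by (rule measurable_component_singleton[OF assms])
  also have "\<dots> = measurable (zp_haar p I) (count_space UNIV)"
    by (rule measurable_cong_sets) simp_all
  finally show ?thesis .
qed

lemma prob_space_zp_haar: "prob_space (zp_haar p I)"
  unfolding zp_haar_def by (intro prob_space_PiM measure_pmf.prob_space_axioms)

lemma zp_haar_cylinder:
  assumes p: "p > 0" and J: "finite J" "J \<subseteq> I \<times> UNIV" and d: "\<And>x. x \<in> J \<Longrightarrow> d x < p"
  shows "measure (zp_haar p I) {\<omega> \<in> space (zp_haar p I). \<forall>x\<in>J. \<omega> x = d x} = (1 / real p) ^ card J"
proof -
  interpret product_prob_space "\<lambda>_::'a \<times> nat. measure_pmf (pmf_of_set {..<p})" "I \<times> UNIV"
    by unfold_locales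
  have "emeasure (zp_haar p I) {\<omega> \<in> space (zp_haar p I). \<forall>x\<in>J. \<omega> x \<in> {d x}} =
      (\<Prod>x\<in>J. emeasure (measure_pmf (pmf_of_set {..<p})) {d x})"
    unfolding zp_haar_def by (rule emeasure_PiM_Collect) (use J in auto)
  also have "\<dots> = (\<Prod>x\<in>J. ennreal (1 / real p))"
    by (intro prod.cong) (use p d in \<open>auto simp: emeasure_pmf_single lessThan_empty_iff\<close>)
  also have "\<dots> = ennreal ((1 / real p) ^ card J)"
    by (simp add: ennreal_power)
  finally show ?thesis by (simp add: measure_def)
qed

lemma zp_res_of_digits:
  assumes "p > 0"
  shows "zp_res p N (\<lambda>j. nat (c div int p ^ j mod int p)) = c mod int p ^ N"
proof (induction N)
  case (Suc N)
  have "c mod int p ^ Suc N = int p ^ N * (c div int p ^ N mod int p) + c mod int p ^ N"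
    using zmod_zmult2_eq[of "int p" c "int p ^ N"] by (simp add: mult.commute)
  then show ?case using Suc assms by (simp add: zp_res_Suc)
qed simp

text \<open>Truncated subtraction gives the right count for e > N too: only the residue 0 is
  left.\<close>

lemma card_residues:
  assumes p: "p > 0"
  shows "card (residues (int p ^ N) (int p ^ e)) = p ^ (N - e)"
proof (cases "e \<le> N")
  case True
  have pe: "int p ^ N = int p ^ e * int p ^ (N - e)" using True by (simp flip: power_add)
  have "residues (int p ^ N) (int p ^ e) = (\<lambda>x. int p ^ e * x) ` {0..<int p ^ (N - e)}"
  proof
    show "residues (int p ^ N) (int p ^ e) \<subseteq> (\<lambda>x. int p ^ e * x) ` {0..<int p ^ (N - e)}"
    proof
      fix w assume w: "w \<in> residues (int p ^ N) (int p ^ e)"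
      then obtain x where x: "w = int p ^ e * x" by (auto simp: residues_def)
      have pe0: "0 < int p ^ e" using p by simp
      have "int p ^ e * 0 \<le> int p ^ e * x" "int p ^ e * x < int p ^ e * int p ^ (N - e)"
        using w unfolding residues_def x pe by simp_all
      then have "0 \<le> x" "x < int p ^ (N - e)"
        unfolding mult_le_cancel_left_pos[OF pe0] mult_less_cancel_left_pos[OF pe0] .
      then show "w \<in> (\<lambda>x. int p ^ e * x) ` {0..<int p ^ (N - e)}" using x by auto
    qed
    show "(\<lambda>x. int p ^ e * x) ` {0..<int p ^ (N - e)} \<subseteq> residues (int p ^ N) (int p ^ e)"
      using p by (auto simp: residues_def pe)
  qed
  moreover have "inj_on (\<lambda>x. int p ^ e * x) {0..<int p ^ (N - e)}"
    using p by (auto intro!: inj_onI)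
  ultimately show ?thesis by (simp add: card_image nat_power_eq)
next
  case False
  have "residues (int p ^ N) (int p ^ e) = {0}"
  proof
    show "residues (int p ^ N) (int p ^ e) \<subseteq> {0}"
    proof
      fix w assume w: "w \<in> residues (int p ^ N) (int p ^ e)"
      have "int p ^ N dvd int p ^ e" using False by (intro le_imp_power_dvd) simp
      then have "int p ^ N dvd w" using w by (auto simp: residues_def intro: dvd_trans)
      moreover have "0 \<le> w" "w < int p ^ N" using w by (auto simp: residues_def)
      ultimately show "w \<in> {0}" using zdvd_not_zless[of w "int p ^ N"] by force
    qed
  qed (use p in \<open>auto simp: residues_def\<close>)
  then show ?thesis using False by simp
qed

text \<open>Model (i) is I = {..n} and e = 0; models (ii) and (iii) are I = {..<n} with e = 0 and e = 1.\<close>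

definition random_coeffs :: "nat \<Rightarrow> nat set \<Rightarrow> (nat \<times> nat \<Rightarrow> nat) \<Rightarrow> nat \<Rightarrow> nat \<Rightarrow> nat" where
  "random_coeffs e I \<omega> i j = (if i \<in> I then if j < e then 0 else \<omega> (i, j) else zp_one j)"

definition residue_vector :: "nat \<Rightarrow> nat \<Rightarrow> nat set \<Rightarrow> nat \<Rightarrow> (nat \<times> nat \<Rightarrow> nat) \<Rightarrow> nat \<Rightarrow> int" where
  "residue_vector p e I N \<omega> = (\<lambda>i\<in>I. zp_res p N (random_coeffs e I \<omega> i))"

lemma zp_res_one:
  assumes "N > 0"
  shows "zp_res p N zp_one = 1"
proof -
  obtain k where N: "N = Suc k" using assms gr0_implies_Suc by blast
  have "zp_res p k (\<lambda>j. zp_one (Suc j)) = 0" by (simp add: zp_res_def zp_one_def)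
  then show ?thesis by (simp add: N zp_res_Suc_shift zp_one_def)
qed

lemma fill_residue_vector:
  assumes "N > 0"
  shows "fill I (residue_vector p e I N \<omega>) i = zp_res p N (random_coeffs e I \<omega> i)"
proof (cases "i \<in> I")
  case False
  then have "random_coeffs e I \<omega> i = zp_one" by (auto simp: random_coeffs_def)
  then show ?thesis using False assms by (simp add: fill_def zp_res_one)
qed (simp add: fill_def residue_vector_def)

lemma zp_poly_residue_vector:
  assumes "N > 0"
  shows "zp_poly p n (random_coeffs e I \<omega>) m N = scaled_poly p n m (fill I (residue_vector p e I N \<omega>))"
proof -
  have "fill I (residue_vector p e I N \<omega>) = (\<lambda>i. zp_res p N (random_coeffs e I \<omega> i))"
    by (rule ext) (rule fill_residue_vector[OF assms])
  then show ?thesis by (simp add: zp_poly_def)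
qed

lemma random_coeffs_measurable:
  "(\<lambda>\<omega>. random_coeffs e I \<omega> i j) \<in> measurable (zp_haar p I) (count_space UNIV)"
  by (cases "i \<in> I"; cases "j < e") (auto simp: random_coeffs_def intro: measurable_zp_haar_component)

lemma measurable_zp_res:
  assumes "\<And>j. (\<lambda>\<omega>. c \<omega> j) \<in> measurable M (count_space UNIV)"
  shows "(\<lambda>\<omega>. zp_res p N (c \<omega>)) \<in> measurable M (count_space UNIV)"
proof (induction N)
  case (Suc N)
  have "(\<lambda>\<omega>. i + int (c \<omega> N) * int p ^ N) \<in> measurable M (count_space UNIV)" for i
    by (rule measurable_compose[OF assms]) simp
  then show ?case unfolding zp_res_Suc
    by (rule measurable_compose_countable[where f = "\<lambda>i \<omega>. i + int (c \<omega> N) * int p ^ N"]) (rule Suc)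
qed simp

lemma measurable_map_count_space:
  fixes f :: "'i \<Rightarrow> 'a \<Rightarrow> 'b::countable"
  assumes "\<And>i. f i \<in> measurable M (count_space UNIV)"
  shows "(\<lambda>\<omega>. map (\<lambda>i. f i \<omega>) xs) \<in> measurable M (count_space UNIV)"
proof (induction xs)
  case (Cons x xs)
  have "(\<lambda>\<omega>. f x \<omega> # ys) \<in> measurable M (count_space UNIV)" for ys
    by (rule measurable_compose[OF assms]) simp
  then show ?case unfolding list.map
    by (rule measurable_compose_countable[where f = "\<lambda>ys \<omega>. f x \<omega> # ys"]) (rule Cons)
qed simp

text \<open>Q may look only at the first n + 1 coefficients, so it factors through a list of
  integers. Lists of integers form a countable type, on which every predicate is measurable.\<close>

lemma pred_residues:
  fixes c :: "'a \<Rightarrow> nat \<Rightarrow> nat \<Rightarrow> nat"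
  assumes c: "\<And>i j. (\<lambda>\<omega>. c \<omega> i j) \<in> measurable M (count_space UNIV)"
    and Q: "\<And>w w'. (\<And>i. i \<le> n \<Longrightarrow> w i = w' i) \<Longrightarrow> Q w = Q w'"
  shows "Measurable.pred M (\<lambda>\<omega>. Q (\<lambda>i. zp_res p N (c \<omega> i)))"
proof -
  define V where "V \<omega> = map (\<lambda>i. zp_res p N (c \<omega> i)) [0..<Suc n]" for \<omega>
  have "V \<in> measurable M (count_space UNIV)"
    unfolding V_def by (rule measurable_map_count_space, rule measurable_zp_res, rule c)
  then have "Measurable.pred M (\<lambda>\<omega>. Q (\<lambda>i. V \<omega> ! i))"
    by (rule measurable_compose) simp
  moreover have "Q (\<lambda>i. V \<omega> ! i) = Q (\<lambda>i. zp_res p N (c \<omega> i))" for \<omega>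
    by (rule Q) (simp add: V_def del: upt_Suc)
  ultimately show ?thesis by simp
qed

lemma scaled_poly_cong: "(\<And>i. i \<le> n \<Longrightarrow> w i = w' i) \<Longrightarrow> scaled_poly p n m w = scaled_poly p n m w'"
  by (simp add: scaled_poly_def)

lemma pred_zp_poly:
  assumes c: "\<And>i j. (\<lambda>\<omega>. c \<omega> i j) \<in> measurable M (count_space UNIV)"
  shows "Measurable.pred M (\<lambda>\<omega>. Q (zp_poly p n (c \<omega>) m N))"
  unfolding zp_poly_def
  by (rule pred_residues[where Q = "\<lambda>w. Q (scaled_poly p n m w)" and n = n, OF c])
     (simp cong: scaled_poly_cong)

text \<open>Prescribing the random digits by those of c already produces c, so the event contains a
  cylinder of known measure; \<open>residue_vector_uniform\<close> turns these lower bounds into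
  equalities.\<close>

lemma prob_residue_vector_ge:
  fixes c :: "nat \<Rightarrow> int"
  assumes "p > 0" "finite I" "c \<in> (\<Pi>\<^sub>E i\<in>I. residues (int p ^ N) (int p ^ e))"
  shows "1 / real (card (\<Pi>\<^sub>E i\<in>I. residues (int p ^ N) (int p ^ e))) \<le>
    measure (zp_haar p I) {\<omega> \<in> space (zp_haar p I). residue_vector p e I N \<omega> = c}"
proof -
  interpret prob_space "zp_haar p I" by (rule prob_space_zp_haar)
  define d where "d i j = nat (c i div int p ^ j mod int p)" for i j
  \<comment> \<open>Only the positions from e on are random; \<open>random_coeffs\<close> sets those
    below e to 0, in accordance with p^e dividing c.\<close>
  let ?J = "I \<times> {e..<N}"
  have dp: "d i j < p" for i j using assms(1) by (simp add: d_def nat_less_iff)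
  have res: "zp_res p N (d i) = c i" if "i \<in> I" for i
    using zp_res_of_digits[OF assms(1), of N "c i"] assms(3) that
    by (simp add: d_def[abs_def] PiE_iff residues_def)
  have d0: "d i j = 0" if "i \<in> I" "j < e" for i j
  proof -
    have "int p ^ e dvd c i" using assms(3) that(1) by (auto simp: PiE_iff residues_def)
    moreover have "int p ^ Suc j dvd int p ^ e" using that(2) by (intro le_imp_power_dvd) simp
    ultimately have "int p ^ Suc j dvd c i" by (rule dvd_trans[rotated])
    then obtain x where "c i = int p ^ Suc j * x" by (rule dvdE)
    then have "c i = int p ^ j * (int p * x)" by simp
    then show ?thesis using assms(1) by (simp add: d_def)
  qed
  have "{\<omega> \<in> space (zp_haar p I). \<forall>x\<in>?J. \<omega> x = d (fst x) (snd x)} \<subseteq>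
      {\<omega> \<in> space (zp_haar p I). residue_vector p e I N \<omega> = c}"
  proof safe
    fix \<omega> assume \<omega>: "\<forall>x\<in>?J. \<omega> x = d (fst x) (snd x)"
    show "residue_vector p e I N \<omega> = c"
    proof
      fix i
      show "residue_vector p e I N \<omega> i = c i"
      proof (cases "i \<in> I")
        case True
        have "zp_res p N (random_coeffs e I \<omega> i) = zp_res p N (d i)"
          unfolding zp_res_def
          by (rule sum.cong) (use True \<omega> d0 in \<open>auto simp: random_coeffs_def\<close>)
        then show ?thesis using True res by (simp add: residue_vector_def)
      next
        case False
        then show ?thesis using assms(3) by (auto simp: residue_vector_def PiE_iff extensional_def)
      qed
    qed
  qed
  then have "measure (zp_haar p I) {\<omega> \<in> space (zp_haar p I). \<forall>x\<in>?J. \<omega> x = d (fst x) (snd x)} \<le>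
      measure (zp_haar p I) {\<omega> \<in> space (zp_haar p I). residue_vector p e I N \<omega> = c}"
  proof (rule finite_measure_mono)
    have "Measurable.pred (zp_haar p I) (\<lambda>\<omega>. \<forall>i\<in>I. residue_vector p e I N \<omega> i = c i)"
    proof (rule pred_intros_finite(3)[OF assms(2)])
      fix i assume "i \<in> I"
      have "(\<lambda>\<omega>. zp_res p N (random_coeffs e I \<omega> i)) \<in> measurable (zp_haar p I) (count_space UNIV)"
        by (rule measurable_zp_res, rule random_coeffs_measurable)
      then have "Measurable.pred (zp_haar p I) (\<lambda>\<omega>. zp_res p N (random_coeffs e I \<omega> i) = c i)"
        by (rule measurable_compose) simp
      then show "Measurable.pred (zp_haar p I) (\<lambda>\<omega>. residue_vector p e I N \<omega> i = c i)"
        using \<open>i \<in> I\<close> by (simp add: residue_vector_def)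
    qed
    moreover have "residue_vector p e I N \<omega> = c \<longleftrightarrow> (\<forall>i\<in>I. residue_vector p e I N \<omega> i = c i)" for \<omega>
      using assms(3) by (auto simp: residue_vector_def PiE_iff extensional_def fun_eq_iff)
    ultimately show "{\<omega> \<in> space (zp_haar p I). residue_vector p e I N \<omega> = c} \<in> events"
      by (simp add: pred_def)
  qed
  moreover have "measure (zp_haar p I) {\<omega> \<in> space (zp_haar p I). \<forall>x\<in>?J. \<omega> x = d (fst x) (snd x)} =
      (1 / real p) ^ card ?J"
    by (rule zp_haar_cylinder) (use assms dp in auto)
  moreover have "card (\<Pi>\<^sub>E i\<in>I. residues (int p ^ N) (int p ^ e)) = p ^ card ?J"
    using assms by (simp add: card_PiE card_residues card_cartesian_product mult.commute[of "card I"] power_mult)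
  ultimately show ?thesis by (simp add: power_one_over)
qed

lemma pred_residue_vector:
  fixes I :: "nat set"
  assumes "finite I"
  shows "Measurable.pred (zp_haar p I) (\<lambda>\<omega>. Q (residue_vector p e I N \<omega>))"
proof -
  define n where "n = Max (insert 0 I)"
  have n: "i \<le> n" if "i \<in> I" for i using assms that by (simp add: n_def)
  have "Measurable.pred (zp_haar p I)
     (\<lambda>\<omega>. (\<lambda>w. Q (\<lambda>i\<in>I. w i)) (\<lambda>i. zp_res p N (random_coeffs e I \<omega> i)))"
  proof (rule pred_residues[where n = n])
    show "Q (restrict w I) = Q (restrict w' I)" if "\<And>i. i \<le> n \<Longrightarrow> w i = w' i" for w w'
      using that n by (metis (mono_tags, lifting) restrict_ext)
  qed (rule random_coeffs_measurable)
  then show ?thesis by (simp add: residue_vector_def)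
qed

text \<open>The pointwise lower bounds, summed over Q and over its negation, add up to 1, the total
  mass. So both are equalities.\<close>

lemma residue_vector_uniform:
  fixes I :: "nat set" and N e :: nat
  assumes p: "p > 0" and I: "finite I"
  defines "X \<equiv> (\<Pi>\<^sub>E i\<in>I. residues (int p ^ N) (int p ^ e))"
  shows "measure (zp_haar p I) {\<omega> \<in> space (zp_haar p I). Q (residue_vector p e I N \<omega>)} =
    real (card {c \<in> X. Q c}) / real (card X)"
proof -
  interpret prob_space "zp_haar p I" by (rule prob_space_zp_haar)
  let ?V = "residue_vector p e I N"
  have finX: "finite X" using I by (simp add: X_def finite_PiE)
  have "card X = (p ^ (N - e)) ^ card I" using I p by (simp add: X_def card_PiE card_residues)
  then have X0: "card X > 0" using p by simp
  have meas: "{\<omega> \<in> space (zp_haar p I). Q (?V \<omega>)} \<in> events" for Q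
    using pred_residue_vector[OF I] by (simp add: pred_def)
  have ge: "real (card {c \<in> X. Q c}) / real (card X) \<le> prob {\<omega> \<in> space (zp_haar p I). Q (?V \<omega>)}" for Q
  proof -
    have "real (card {c \<in> X. Q c}) / real (card X) = (\<Sum>c\<in>{c \<in> X. Q c}. 1 / real (card X))"
      by simp
    also have "\<dots> \<le> (\<Sum>c\<in>{c \<in> X. Q c}. prob {\<omega> \<in> space (zp_haar p I). ?V \<omega> = c})"
      by (intro sum_mono) (use prob_residue_vector_ge[OF p I] in \<open>auto simp: X_def\<close>)
    also have "\<dots> = prob (\<Union>c\<in>{c \<in> X. Q c}. {\<omega> \<in> space (zp_haar p I). ?V \<omega> = c})"
      by (rule finite_measure_finite_Union[symmetric])
         (use finX meas[of "\<lambda>c. c = _"] in \<open>auto simp: disjoint_family_on_def\<close>)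
    also have "\<dots> \<le> prob {\<omega> \<in> space (zp_haar p I). Q (?V \<omega>)}"
      by (rule finite_measure_mono[OF _ meas]) auto
    finally show ?thesis .
  qed
  have "{\<omega> \<in> space (zp_haar p I). \<not> Q (?V \<omega>)} = space (zp_haar p I) - {\<omega> \<in> space (zp_haar p I). Q (?V \<omega>)}"
    by auto
  then have "prob {\<omega> \<in> space (zp_haar p I). \<not> Q (?V \<omega>)} = 1 - prob {\<omega> \<in> space (zp_haar p I). Q (?V \<omega>)}"
    using prob_compl[OF meas[of Q]] by simp
  moreover have "card {c \<in> X. \<not> Q c} = card X - card {c \<in> X. Q c}"
    using card_Diff_subset[of "{c \<in> X. Q c}" X] finX by (simp add: set_diff_eq Collect_conj_eq[symmetric])
      (metis (mono_tags, lifting) Collect_cong mem_Collect_eq)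
  moreover have "card {c \<in> X. Q c} \<le> card X" using finX by (intro card_mono) auto
  ultimately have "(real (card X) - real (card {c \<in> X. Q c})) / real (card X) \<le>
      1 - prob {\<omega> \<in> space (zp_haar p I). Q (?V \<omega>)}"
    using ge[of "\<lambda>c. \<not> Q c"] by (simp add: of_nat_diff)
  then have "prob {\<omega> \<in> space (zp_haar p I). Q (?V \<omega>)} \<le> real (card {c \<in> X. Q c}) / real (card X)"
    using X0 by (simp add: diff_divide_distrib)
  with ge[of Q] show ?thesis by simp
qed

lemma prob_hensel_density:
  assumes p: "prime p" and I: "finite I" and S: "S \<subseteq> labels p k"
  shows "measure (zp_haar p I) {\<omega> \<in> space (zp_haar p I).
      \<forall>s\<in>S. hensel_class p k (zp_poly p n (random_coeffs e I \<omega>) (fst s) (2 * k)) (int (snd s))} =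
    hensel_density p k e I n S"
proof -
  have pp: "p > 0" using p by (simp add: prime_gt_0_nat)
  have "(\<forall>s\<in>S. hensel_class p k (zp_poly p n (random_coeffs e I \<omega>) (fst s) (2 * k)) (int (snd s))) \<longleftrightarrow>
     (\<forall>s\<in>S. hensel_class p k (scaled_poly p n (fst s) (fill I (residue_vector p e I (2 * k) \<omega>))) (int (snd s)))"
    for \<omega>
  \<comment> \<open>At precision 0 the residue of \<open>zp_one\<close> is 0, whereas
    \<open>fill\<close> supplies 1; but there are no labels of level 0.\<close>
  proof (cases "k = 0")
    case True
    then show ?thesis using S by simp
  qed (simp add: zp_poly_residue_vector)
  then show ?thesis unfolding hensel_density_def residue_vector_uniform[OF pp I, symmetric] by simp
qed

section \<open>Measurability and passage to the limit\<close>

lemma pred_card_eq: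
  fixes P :: "'b \<Rightarrow> 'a \<Rightarrow> bool"
  assumes A: "finite A" and P: "\<And>s. s \<in> A \<Longrightarrow> Measurable.pred M (P s)"
  shows "Measurable.pred M (\<lambda>\<omega>. card {s \<in> A. P s \<omega>} = r)"
proof -
  have "card {s \<in> A. P s \<omega>} = r \<longleftrightarrow>
      (\<exists>T\<in>{T. T \<subseteq> A \<and> card T = r}. \<forall>s\<in>A. P s \<omega> \<longleftrightarrow> s \<in> T)" for \<omega>
  proof
    assume "\<exists>T\<in>{T. T \<subseteq> A \<and> card T = r}. \<forall>s\<in>A. P s \<omega> \<longleftrightarrow> s \<in> T"
    then obtain T where T: "T \<subseteq> A" "card T = r" "\<forall>s\<in>A. P s \<omega> \<longleftrightarrow> s \<in> T" by blast
    then have "{s \<in> A. P s \<omega>} = T" by blast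
    then show "card {s \<in> A. P s \<omega>} = r" using T by simp
  next
    assume "card {s \<in> A. P s \<omega>} = r"
    then show "\<exists>T\<in>{T. T \<subseteq> A \<and> card T = r}. \<forall>s\<in>A. P s \<omega> \<longleftrightarrow> s \<in> T"
      by (intro bexI[of _ "{s \<in> A. P s \<omega>}"]) auto
  qed
  moreover have "Measurable.pred M (\<lambda>\<omega>. \<exists>T\<in>{T. T \<subseteq> A \<and> card T = r}. \<forall>s\<in>A. P s \<omega> \<longleftrightarrow> s \<in> T)"
  proof (rule pred_intros_finite)
    show "finite {T. T \<subseteq> A \<and> card T = r}"
      by (rule finite_subset[of _ "Pow A"]) (use A in auto)
    show "Measurable.pred M (\<lambda>\<omega>. \<forall>s\<in>A. P s \<omega> \<longleftrightarrow> s \<in> T)" for T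
    proof (rule pred_intros_finite[OF A])
      fix s assume "s \<in> A"
      from P[OF this] show "Measurable.pred M (\<lambda>\<omega>. P s \<omega> \<longleftrightarrow> s \<in> T)" by simp
    qed
  qed
  ultimately show ?thesis by simp
qed

lemma measurable_card_eqI:
  fixes X :: "'a \<Rightarrow> nat"
  assumes "\<And>r. Measurable.pred M (\<lambda>\<omega>. X \<omega> = r)"
  shows "X \<in> measurable M (count_space UNIV)"
  unfolding measurable_count_space_eq2_countable
proof (intro conjI ballI)
  fix r
  have "X -` {r} \<inter> space M = {\<omega> \<in> space M. X \<omega> = r}" by auto
  then show "X -` {r} \<inter> space M \<in> sets M" using assms[of r] by (simp add: pred_def)
qed auto

text \<open>Compactness replaces the quantifier over the uncountably many u by a countable
  conjunction, each member of which depends on finitely many digits of the coefficients. This yields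
  measurability.\<close>

lemma root_labels_iff:
  assumes p: "prime p" and s: "(m, a) \<in> labels p k"
  shows "(m, a) \<in> root_labels p n c k \<longleftrightarrow>
    (\<forall>K. \<exists>b. int p ^ k dvd b - int a \<and> int p ^ K dvd poly (zp_poly p n c m K) b)"
proof
  assume "(m, a) \<in> root_labels p n c k"
  then obtain u where u: "zp_digits p u" "zp_res p k u = int a" "qp_is_root p n c (m, u)"
    by (auto simp: root_labels_def)
  show "\<forall>K. \<exists>b. int p ^ k dvd b - int a \<and> int p ^ K dvd poly (zp_poly p n c m K) b"
  proof (intro allI exI conjI)
    fix K
    show "int p ^ k dvd zp_res p (k + K) u - int a"
      unfolding u(2)[symmetric] by (rule zp_res_cong) simp
    have "int p ^ K dvd zp_res p (k + K) u - zp_res p K u" by (rule zp_res_cong) simp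
    from poly_diff_dvd[OF this] u(3)
    show "int p ^ K dvd poly (zp_poly p n c m K) (zp_res p (k + K) u)"
      unfolding qp_is_root_iff by (metis dvd_diff_left_iff)
  qed
next
  assume "\<forall>K. \<exists>b. int p ^ k dvd b - int a \<and> int p ^ K dvd poly (zp_poly p n c m K) b"
  then have ex: "\<exists>b. int p ^ k dvd b - int a \<and> int p ^ K dvd poly (zp_poly p n c m K) b" for K
    by blast
  have "p > 0" using p by (simp add: prime_gt_0_nat)
  from zp_root_compactness[OF this ex]
  obtain u where "zp_digits p u" "int p ^ k dvd zp_res p k u - int a" "qp_is_root p n c (m, u)" .
  moreover have "a < p ^ k" using s by (simp add: labels_def)
  ultimately show "(m, a) \<in> root_labels p n c k"
    using s zp_res_eq_iff_dvd by (auto simp: root_labels_def)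
qed

lemma measurable_num_roots:
  assumes p: "prime p" and c: "\<And>i j. (\<lambda>\<omega>. c \<omega> i j) \<in> measurable M (count_space UNIV)"
  shows "(\<lambda>\<omega>. num_roots p n (c \<omega>)) \<in> measurable M (count_space UNIV)"
proof (rule measurable_card_eqI)
  have pp: "p > 0" using p by (simp add: prime_gt_0_nat)
  have label: "Measurable.pred M (\<lambda>\<omega>. s \<in> root_labels p n (c \<omega>) k)" if "s \<in> labels p k" for s k
  proof -
    obtain m a where s: "s = (m, a)" by fastforce
    have "Measurable.pred M (\<lambda>\<omega>. \<forall>K. \<exists>b. int p ^ k dvd b - int a \<and>
        int p ^ K dvd poly (zp_poly p n (c \<omega>) m K) b)"
      by (intro pred_intros_countable(1)
            pred_zp_poly[where Q = "\<lambda>f. \<exists>b. int p ^ k dvd b - int a \<and> int p ^ _ dvd poly f b"] c)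
    then show ?thesis using root_labels_iff[OF p, of m a k] that by (simp add: s)
  qed
  have card: "Measurable.pred M (\<lambda>\<omega>. card (root_labels p n (c \<omega>) k) = r)" for k r
  proof -
    have "root_labels p n (c \<omega>) k = {s \<in> labels p k. s \<in> root_labels p n (c \<omega>) k}" for \<omega>
      by (auto simp: root_labels_def)
    moreover have "Measurable.pred M (\<lambda>\<omega>. card {s \<in> labels p k. s \<in> root_labels p n (c \<omega>) k} = r)"
      by (rule pred_card_eq) (auto intro: label)
    ultimately show ?thesis by simp
  qed
  have pos: "Measurable.pred M (\<lambda>\<omega>. num_roots p n (c \<omega>) = r)" if "r > 0" for r
    unfolding num_roots_eq_iff_root_labels[OF pp that] eventually_sequentially
    by (intro pred_intros_countable pred_intros_logic card) simp_all
  fix r show "Measurable.pred M (\<lambda>\<omega>. num_roots p n (c \<omega>) = r)"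
  proof (cases "r = 0")
    case True
    \<comment> \<open>The value 0 is obtained as the complement of the positive ones; it includes
      the polynomials with infinitely many roots, where \<open>card\<close> is 0.\<close>
    have "num_roots p n (c \<omega>) = 0 \<longleftrightarrow> (\<forall>r. \<not> num_roots p n (c \<omega>) = Suc r)" for \<omega>
      by (metis not0_implies_Suc nat.distinct(1))
    moreover have "Measurable.pred M (\<lambda>\<omega>. \<forall>r. \<not> num_roots p n (c \<omega>) = Suc r)"
      by (intro pred_intros_countable pred_intros_logic pos) simp
    ultimately show ?thesis using True by simp
  qed (use pos in simp)
qed

lemma pred_hensel_labels:
  assumes c: "\<And>i j. (\<lambda>\<omega>. c \<omega> i j) \<in> measurable M (count_space UNIV)"
  shows "Measurable.pred M (\<lambda>\<omega>. s \<in> hensel_labels p n (c \<omega>) k)"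
  unfolding hensel_labels_def mem_Collect_eq
  by (intro pred_intros_logic
      pred_zp_poly[where Q = "\<lambda>f. hensel_class p k f (int (snd s))"] c) simp

lemma pred_exceptional:
  assumes c: "\<And>i j. (\<lambda>\<omega>. c \<omega> i j) \<in> measurable M (count_space UNIV)"
  shows "Measurable.pred M (\<lambda>\<omega>. exceptional p n (c \<omega>) k)"
proof -
  have "Measurable.pred M (\<lambda>\<omega>. int p ^ k dvd zp_res p k (c \<omega> n))"
    by (rule pred_residues[where Q = "\<lambda>w. int p ^ k dvd w n" and n = n, OF c]) simp
  moreover have "Measurable.pred M (\<lambda>\<omega>. \<exists>s\<in>labels p k.
      int p ^ (2 * k) dvd poly (zp_poly p n (c \<omega>) (fst s) (2 * k)) (int (snd s)))"
    by (intro pred_intros_finite finite_labels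
       pred_zp_poly[where Q = "\<lambda>f. int p ^ (2 * k) dvd poly f (int (snd _))"] c)
  ultimately show ?thesis
    unfolding exceptional_def case_prod_beta by (rule pred_intros_logic)
qed

text \<open>Off the exceptional sets, whose probabilities are summable, the number of roots equals the number
  of Hensel labels; since the latter is always a lower bound, Fatou's lemma suffices and no bound on
  the number of roots of a polynomial is needed.\<close>

lemma expectation_num_roots_choose:
  assumes p: "prime p" and I: "finite I"
    and ex: "summable (\<lambda>k. measure (zp_haar p I)
      {\<omega> \<in> space (zp_haar p I). exceptional p n (random_coeffs e I \<omega>) k})"
  shows "(\<integral>\<omega>. real (num_roots p n (random_coeffs e I \<omega>) choose d) \<partial>zp_haar p I) =
    enn2real (liminf (\<lambda>k. \<Sum>S\<in>{S. S \<subseteq> labels p k \<and> card S = d}. ennreal (hensel_density p k e I n S)))"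
proof -
  interpret prob_space "zp_haar p I" by (rule prob_space_zp_haar)
  let ?M = "zp_haar p I"
  define c where "c = random_coeffs e I"
  have c: "(\<lambda>\<omega>. c \<omega> i j) \<in> measurable ?M (count_space UNIV)" for i j
    unfolding c_def by (rule random_coeffs_measurable)
  define X where "X \<omega> = num_roots p n (c \<omega>)" for \<omega>
  define Y where "Y k \<omega> = card (hensel_labels p n (c \<omega>) k)" for k \<omega>
  define g where "g \<omega> = ennreal (real (X \<omega> choose d))" for \<omega>
  define h where "h k \<omega> = ennreal (real (Y k \<omega> choose d))" for k \<omega>
  have Xm: "X \<in> measurable ?M (count_space UNIV)"
    unfolding X_def by (rule measurable_num_roots[OF p c])
  have "(\<lambda>\<omega>. real (X \<omega> choose d)) \<in> borel_measurable ?M"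
    by (rule measurable_compose[OF Xm]) simp
  \<comment> \<open>Were the expectation infinite, both sides would be 0 by convention, so
    integrability is not presupposed.\<close>
  then have "(\<integral>\<omega>. real (X \<omega> choose d) \<partial>?M) = enn2real (\<integral>\<^sup>+\<omega>. g \<omega> \<partial>?M)"
    unfolding g_def by (rule integral_eq_nn_integral) simp
  moreover have "(\<integral>\<^sup>+\<omega>. h k \<omega> \<partial>?M) =
      (\<Sum>S\<in>{S. S \<subseteq> labels p k \<and> card S = d}. ennreal (hensel_density p k e I n S))" for k
  proof -
    define \<S> where "\<S> = {S. S \<subseteq> labels p k \<and> card S = d}"
    have fin: "finite \<S>" unfolding \<S>_def by (rule finite_subset[of _ "Pow (labels p k)"]) auto
    have hsub: "hensel_labels p n (c \<omega>) k \<subseteq> labels p k" for \<omega> by (auto simp: hensel_labels_def)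
    define E where "E S = {\<omega> \<in> space ?M. \<forall>s\<in>S. s \<in> hensel_labels p n (c \<omega>) k}" for S
    have E: "E S \<in> sets ?M" if "S \<in> \<S>" for S
    proof -
      have "finite S" using that by (auto simp: \<S>_def intro: finite_subset)
      then have "Measurable.pred ?M (\<lambda>\<omega>. \<forall>s\<in>S. s \<in> hensel_labels p n (c \<omega>) k)"
        by (intro pred_intros_finite pred_hensel_labels c)
      then show ?thesis by (simp add: E_def pred_def)
    qed
    have "h k \<omega> = (\<Sum>S\<in>\<S>. indicator (E S) \<omega>)" if \<omega>: "\<omega> \<in> space ?M" for \<omega>
    proof -
      have "Y k \<omega> choose d = card {S. S \<subseteq> hensel_labels p n (c \<omega>) k \<and> card S = d}"
        unfolding Y_def by (rule n_subsets[symmetric]) simp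
      also have "{S. S \<subseteq> hensel_labels p n (c \<omega>) k \<and> card S = d} = {S \<in> \<S>. \<omega> \<in> E S}"
        using hsub \<omega> by (auto simp: \<S>_def E_def)
      finally have "h k \<omega> = of_nat (card {S \<in> \<S>. \<omega> \<in> E S})"
        by (simp add: h_def ennreal_of_nat_eq_real_of_nat)
      also have "\<dots> = (\<Sum>S\<in>\<S>. indicator (E S) \<omega>)"
        using fin by (simp add: indicator_def sum.If_cases Int_def)
      finally show ?thesis .
    qed
    then have "(\<integral>\<^sup>+\<omega>. h k \<omega> \<partial>?M) = (\<integral>\<^sup>+\<omega>. (\<Sum>S\<in>\<S>. indicator (E S) \<omega>) \<partial>?M)"
      by (rule nn_integral_cong)
    also have "\<dots> = (\<Sum>S\<in>\<S>. emeasure ?M (E S))"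
      using E by (simp add: nn_integral_sum)
    also have "\<dots> = (\<Sum>S\<in>\<S>. ennreal (hensel_density p k e I n S))"
    proof (rule sum.cong)
      fix S assume S: "S \<in> \<S>"
      then have Sl: "S \<subseteq> labels p k" by (simp add: \<S>_def)
      then have "E S = {\<omega> \<in> space ?M. \<forall>s\<in>S. hensel_class p k (zp_poly p n (c \<omega>) (fst s) (2 * k)) (int (snd s))}"
        by (auto simp: E_def hensel_labels_def)
      then show "emeasure ?M (E S) = ennreal (hensel_density p k e I n S)"
        using prob_hensel_density[OF p I Sl, of n e] by (simp add: emeasure_eq_measure c_def)
    qed simp
    finally show ?thesis by (simp add: \<S>_def)
  qed
  moreover have "(\<integral>\<^sup>+\<omega>. g \<omega> \<partial>?M) = liminf (\<lambda>k. \<integral>\<^sup>+\<omega>. h k \<omega> \<partial>?M)"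
  proof (rule antisym)
    \<comment> \<open>Borel-Cantelli: almost every polynomial is exceptional at only finitely many
      levels.\<close>
    have "AE \<omega> in ?M. \<forall>\<^sub>F k in sequentially. \<omega> \<in> space ?M - {\<omega> \<in> space ?M. exceptional p n (c \<omega>) k}"
      by (rule borel_cantelli_AE1)
         (use pred_exceptional[OF c] ex in \<open>auto simp: pred_def c_def emeasure_eq_measure\<close>)
    then have ae: "AE \<omega> in ?M. \<forall>\<^sub>F k in sequentially. \<not> exceptional p n (c \<omega>) k"
      by (rule AE_mp) (rule AE_I2, auto elim: eventually_mono)
    have Ym: "Y k \<in> measurable ?M (count_space UNIV)" for k
    proof (rule measurable_card_eqI)
      fix r
      have "hensel_labels p n (c \<omega>) k = {s \<in> labels p k. s \<in> hensel_labels p n (c \<omega>) k}" for \<omega>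
        by (auto simp: hensel_labels_def)
      moreover have "Measurable.pred ?M (\<lambda>\<omega>. card {s \<in> labels p k. s \<in> hensel_labels p n (c \<omega>) k} = r)"
        by (rule pred_card_eq) (auto intro: pred_hensel_labels c)
      ultimately show "Measurable.pred ?M (\<lambda>\<omega>. Y k \<omega> = r)" by (simp add: Y_def)
    qed
    have hm: "h k \<in> borel_measurable ?M" for k
      unfolding h_def by (rule measurable_compose[OF Ym]) simp
    have "AE \<omega> in ?M. g \<omega> \<le> liminf (\<lambda>k. h k \<omega>)"
      using ae
    proof eventually_elim
      case (elim \<omega>)
      then have "\<forall>\<^sub>F k in sequentially. g \<omega> \<le> h k \<omega>"
        by eventually_elim (simp add: g_def h_def X_def Y_def not_exceptional_num_roots[OF p])
      then show ?case by (rule Liminf_bounded)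
    qed
    then have "(\<integral>\<^sup>+\<omega>. g \<omega> \<partial>?M) \<le> (\<integral>\<^sup>+\<omega>. liminf (\<lambda>k. h k \<omega>) \<partial>?M)"
      by (rule nn_integral_mono_AE)
    also have "\<dots> \<le> liminf (\<lambda>k. \<integral>\<^sup>+\<omega>. h k \<omega> \<partial>?M)"
      by (rule nn_integral_liminf) (rule hm)
    finally show "(\<integral>\<^sup>+\<omega>. g \<omega> \<partial>?M) \<le> liminf (\<lambda>k. \<integral>\<^sup>+\<omega>. h k \<omega> \<partial>?M)" .
    have "(\<integral>\<^sup>+\<omega>. h k \<omega> \<partial>?M) \<le> (\<integral>\<^sup>+\<omega>. g \<omega> \<partial>?M)" for k
    proof (rule nn_integral_mono_AE)
      show "AE \<omega> in ?M. h k \<omega> \<le> g \<omega>"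
        using ae
      proof eventually_elim
        case (elim \<omega>)
        \<comment> \<open>A single non-exceptional level shows that there are finitely many roots,
          which makes the bound by \<open>card_hensel_labels_le\<close> available at every level
          k.\<close>
        then obtain l where "\<not> exceptional p n (c \<omega>) l" by (auto simp: eventually_sequentially)
        then have "Y k \<omega> \<le> X \<omega>"
          unfolding X_def Y_def using not_exceptional_num_roots(1)[OF p] card_hensel_labels_le[OF p] by blast
        then show ?case by (simp add: g_def h_def binomial_right_mono ennreal_leI)
      qed
    qed
    then have "liminf (\<lambda>k. \<integral>\<^sup>+\<omega>. h k \<omega> \<partial>?M) \<le> liminf (\<lambda>k::nat. \<integral>\<^sup>+\<omega>. g \<omega> \<partial>?M)"
      by (intro Liminf_mono) simp
    then show "liminf (\<lambda>k. \<integral>\<^sup>+\<omega>. h k \<omega> \<partial>?M) \<le> (\<integral>\<^sup>+\<omega>. g \<omega> \<partial>?M)"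
      by (simp add: Liminf_const)
  qed
  ultimately show ?thesis by (simp add: X_def c_def)
qed

section \<open>Degree independence\<close>

text \<open>Once the other coefficients are fixed, the unit \<xi> i0 leaves at most one of the p^(N
  - e) residues for the coefficient i0.\<close>

lemma card_linear_congruence:
  fixes n N e :: nat
  assumes p: "prime p" and I: "I \<subseteq> {..n}" and i0: "i0 \<in> I" "\<not> int p dvd \<xi> i0"
  defines "X \<equiv> (\<Pi>\<^sub>E i\<in>I. residues (int p ^ N) (int p ^ e))"
  shows "real (card {c \<in> X. int p ^ N dvd (\<Sum>i\<le>n. fill I c i * \<xi> i)}) / real (card X) \<le> 1 / real p ^ (N - e)"
proof -
  let ?A = "{c \<in> X. int p ^ N dvd (\<Sum>i\<le>n. fill I c i * \<xi> i)}"
  let ?W = "residues (int p ^ N) (int p ^ e)"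
  have fin: "finite I" using I by (rule finite_subset) simp
  have pp: "p > 0" using p by (simp add: prime_gt_0_nat)
  have "card ?A \<le> card (\<Pi>\<^sub>E i\<in>I - {i0}. ?W)"
  proof (rule card_inj_on_le[where f = "\<lambda>c. restrict c (I - {i0})"])
    show "inj_on (\<lambda>c. restrict c (I - {i0})) ?A"
    proof (rule inj_onI)
      fix a b assume a: "a \<in> ?A" and b: "b \<in> ?A" and eq: "restrict a (I - {i0}) = restrict b (I - {i0})"
      have ab: "a i = b i" if "i \<in> I" "i \<noteq> i0" for i
        using fun_cong[OF eq, of i] that by simp
      have "(\<Sum>i\<le>n. fill I a i * \<xi> i) - (\<Sum>i\<le>n. fill I b i * \<xi> i) =
          (\<Sum>i\<le>n. (fill I a i - fill I b i) * \<xi> i)"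
        by (simp add: sum_subtractf left_diff_distrib)
      also have "\<dots> = (\<Sum>i\<in>{i0}. (fill I a i - fill I b i) * \<xi> i)"
        by (rule sum.mono_neutral_right) (use I i0 ab in \<open>auto simp: fill_def\<close>)
      finally have "int p ^ N dvd (a i0 - b i0) * \<xi> i0"
        using a b i0 dvd_diff[of "int p ^ N" "\<Sum>i\<le>n. fill I a i * \<xi> i" "\<Sum>i\<le>n. fill I b i * \<xi> i"]
        by (simp add: fill_def)
      moreover have "coprime (int p ^ N) (\<xi> i0)"
        using p i0(2) by (auto intro!: prime_imp_coprime)
      ultimately have "int p ^ N dvd a i0 - b i0" by (simp add: coprime_dvd_mult_left_iff)
      moreover have "0 \<le> a i0" "a i0 < int p ^ N" "0 \<le> b i0" "b i0 < int p ^ N"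
        using a b i0 by (auto simp: X_def PiE_iff residues_def)
      ultimately have "a i0 = b i0" by (metis mod_eq_dvd_iff mod_pos_pos_trivial)
      moreover have "a \<in> (\<Pi>\<^sub>E i\<in>I. ?W)" "b \<in> (\<Pi>\<^sub>E i\<in>I. ?W)" using a b by (auto simp: X_def)
      ultimately show "a = b" by (intro PiE_ext[of a I "\<lambda>_. ?W" b]) (use ab in auto)
    qed
    show "(\<lambda>c. restrict c (I - {i0})) ` ?A \<subseteq> (\<Pi>\<^sub>E i\<in>I - {i0}. ?W)"
      by (rule image_subsetI, subst restrict_PiE_iff) (auto simp: X_def)
  qed (use fin in \<open>simp add: finite_PiE\<close>)
  also have "\<dots> = (p ^ (N - e)) ^ (card I - 1)"
    using fin i0 pp by (simp add: card_PiE card_residues)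
  finally have "real (card ?A) \<le> real ((p ^ (N - e)) ^ (card I - 1))"
    by (rule of_nat_mono)
  then have "real (card ?A) \<le> (real p ^ (N - e)) ^ (card I - 1)"
    unfolding of_nat_power .
  moreover have "card I = Suc (card I - 1)" using card.remove[OF fin i0(1)] by simp
  then have "(real p ^ (N - e)) ^ card I = real p ^ (N - e) * (real p ^ (N - e)) ^ (card I - 1)"
    by (metis power_Suc)
  then have "real (card X) = real p ^ (N - e) * (real p ^ (N - e)) ^ (card I - 1)"
    using fin pp by (simp add: X_def card_PiE card_residues)
  ultimately show ?thesis using pp by (simp add: field_simps)
qed

lemma prob_linear_congruence:
  assumes p: "prime p" and e: "e \<le> 1" and I: "I \<subseteq> {..n}" and i0: "i0 \<in> I" "\<not> int p dvd \<xi> i0"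
  shows "measure (zp_haar p I) {\<omega> \<in> space (zp_haar p I).
      int p ^ N dvd (\<Sum>i\<le>n. fill I (residue_vector p e I N \<omega>) i * \<xi> i)} \<le> real p * (1 / real p) ^ N"
proof -
  have pp: "p > 0" using p by (simp add: prime_gt_0_nat)
  have fin: "finite I" using I by (rule finite_subset) simp
  have "measure (zp_haar p I) {\<omega> \<in> space (zp_haar p I).
      int p ^ N dvd (\<Sum>i\<le>n. fill I (residue_vector p e I N \<omega>) i * \<xi> i)} \<le> 1 / real p ^ (N - e)"
    unfolding residue_vector_uniform[OF pp fin,
        where Q = "\<lambda>c. int p ^ N dvd (\<Sum>i\<le>n. fill I c i * \<xi> i)"]
    by (rule card_linear_congruence[where \<xi> = \<xi>, OF p I i0])
  \<comment> \<open>The factor p pays for the digit that is fixed when e = 1.\<close>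
  also have "real p ^ N \<le> real p ^ Suc (N - e)"
    using pp e by (intro power_increasing) auto
  then have "1 / real p ^ (N - e) \<le> real p * (1 / real p) ^ N"
    using pp by (simp add: field_simps power_one_over)
  finally show ?thesis .
qed

text \<open>At level k the leading coefficient contributes p^(1 - k), and at most k p^k labels
  contribute p^(1 - 2k) each; the total is (k + 1) p^(1 - k).\<close>

lemma summable_exceptional:
  assumes p: "prime p" and I: "finite I"
    and lead: "\<And>k. measure (zp_haar p I) {\<omega> \<in> space (zp_haar p I).
       int p ^ k dvd zp_res p k (random_coeffs e I \<omega> n)} \<le> real p * (1 / real p) ^ k"
    and label: "\<And>k m a. (m, a) \<in> labels p k \<Longrightarrow> measure (zp_haar p I) {\<omega> \<in> space (zp_haar p I).
       int p ^ (2 * k) dvd poly (zp_poly p n (random_coeffs e I \<omega>) m (2 * k)) (int a)} \<le>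
       real p * (1 / real p) ^ (2 * k)"
  shows "summable (\<lambda>k. measure (zp_haar p I)
      {\<omega> \<in> space (zp_haar p I). exceptional p n (random_coeffs e I \<omega>) k})"
proof (rule summable_comparison_test')
  interpret prob_space "zp_haar p I" by (rule prob_space_zp_haar)
  have p1: "real p > 1" using p prime_gt_1_nat by simp
  show "summable (\<lambda>k. real p * (of_nat (Suc k) * (1 / real p) ^ k))"
    by (intro summable_mult sums_summable[OF geometric_deriv_sums]) (use p1 in simp)
  fix k :: nat
  let ?c = "random_coeffs e I"
  let ?A = "{\<omega> \<in> space (zp_haar p I). int p ^ k dvd zp_res p k (?c \<omega> n)}"
  let ?B = "\<lambda>s. {\<omega> \<in> space (zp_haar p I).
      int p ^ (2 * k) dvd poly (zp_poly p n (?c \<omega>) (fst s) (2 * k)) (int (snd s))}"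
  have A: "?A \<in> events"
    using pred_residues[where Q = "\<lambda>w. int p ^ k dvd w n" and n = n, OF random_coeffs_measurable]
    by (simp add: pred_def)
  have B: "?B s \<in> events" for s
    using pred_zp_poly[where Q = "\<lambda>f. int p ^ (2 * k) dvd poly f (int (snd s))", OF random_coeffs_measurable]
    by (simp add: pred_def)
  have "{\<omega> \<in> space (zp_haar p I). exceptional p n (?c \<omega>) k} = ?A \<union> (\<Union>s\<in>labels p k. ?B s)"
    by (auto simp: exceptional_def)
  then have "prob {\<omega> \<in> space (zp_haar p I). exceptional p n (?c \<omega>) k} \<le> prob ?A + prob (\<Union>s\<in>labels p k. ?B s)"
    using A B by (simp add: measure_Un_le sets.finite_UN)
  also have "prob (\<Union>s\<in>labels p k. ?B s) \<le> (\<Sum>s\<in>labels p k. prob (?B s))"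
    by (rule finite_measure_subadditive_finite) (use B in auto)
  also have "\<dots> \<le> (\<Sum>s\<in>labels p k. real p * (1 / real p) ^ (2 * k))"
    by (intro sum_mono) (use label in auto)
  also have "\<dots> \<le> real (k * p ^ k) * (real p * (1 / real p) ^ (2 * k))"
  proof -
    have "card (labels p k) \<le> card ({..<k} \<times> {..<p ^ k})"
      by (rule card_mono[OF _ labels_subset]) simp
    then have "real (card (labels p k)) \<le> real (k * p ^ k)"
      by (simp only: of_nat_le_iff card_cartesian_product card_lessThan)
    then show ?thesis by (simp add: mult_right_mono del: of_nat_mult of_nat_power)
  qed
  also have "\<dots> = real k * (real p * (1 / real p) ^ k)"
    using p1 by (simp add: mult_2 power_add power_one_over)
  also note lead[of k]
  finally show "norm (prob {\<omega> \<in> space (zp_haar p I). exceptional p n (?c \<omega>) k}) \<le>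
      real p * (of_nat (Suc k) * (1 / real p) ^ k)"
    by (simp add: algebra_simps)
qed

lemma prob_label:
  assumes p: "prime p" and e: "e \<le> 1" and I: "I \<subseteq> {..n}" and s: "(m, a) \<in> labels p k"
    and i0: "i0 \<in> I" "\<not> int p dvd int p ^ (m * (n - i0)) * int a ^ i0"
  shows "measure (zp_haar p I) {\<omega> \<in> space (zp_haar p I).
       int p ^ (2 * k) dvd poly (zp_poly p n (random_coeffs e I \<omega>) m (2 * k)) (int a)} \<le>
       real p * (1 / real p) ^ (2 * k)"
proof -
  have "2 * k > 0" using s by (auto simp: labels_def)
  then show ?thesis
    using prob_linear_congruence[where \<xi> = "\<lambda>i. int p ^ (m * (n - i)) * int a ^ i" and N = "2 * k", OF p e I i0]
    by (simp add: zp_poly_residue_vector poly_scaled_poly mult.assoc)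
qed

lemma prob_le_at_0:
  assumes "p > 0"
  shows "measure (zp_haar p I) A \<le> real p * (1 / real p) ^ 0"
proof -
  interpret prob_space "zp_haar p I" by (rule prob_space_zp_haar)
  have "prob A \<le> 1" by simp
  also have "1 \<le> real p" using assms by simp
  finally show ?thesis by simp
qed

text \<open>The unit weight that \<open>prob_label\<close> asks for belongs to the constant
  coefficient if m = 0 and is the weight a^n of the leading coefficient, with a prime to p, if m >
  0.\<close>

lemma summable_exceptional_general:
  assumes p: "prime p"
  shows "summable (\<lambda>k. measure (zp_haar p {..n})
      {\<omega> \<in> space (zp_haar p {..n}). exceptional p n (random_coeffs 0 {..n} \<omega>) k})"
proof (rule summable_exceptional[OF p])
  have p1: "p > 1" using p prime_gt_1_nat by simp
  show "measure (zp_haar p {..n}) {\<omega> \<in> space (zp_haar p {..n}).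
     int p ^ k dvd zp_res p k (random_coeffs 0 {..n} \<omega> n)} \<le> real p * (1 / real p) ^ k" for k
  proof (cases "k = 0")
    case True
    then show ?thesis using prob_le_at_0[of p] p1 by auto
  next
    case False
    have "(\<Sum>i\<le>n. fill {..n} (residue_vector p 0 {..n} k \<omega>) i * (if i = n then 1 else 0))
        = zp_res p k (random_coeffs 0 {..n} \<omega> n)" for \<omega>
    proof -
      have "(\<Sum>i\<le>n. fill {..n} (residue_vector p 0 {..n} k \<omega>) i * (if i = n then 1 else 0)) =
          (\<Sum>i\<le>n. if i = n then zp_res p k (random_coeffs 0 {..n} \<omega> i) else 0)"
        by (rule sum.cong) (use False in \<open>auto simp: fill_residue_vector\<close>)
      then show ?thesis by simp
    qed
    then show ?thesis
      using prob_linear_congruence[OF p, of 0 "{..n}" n n "\<lambda>i. if i = n then 1 else 0" k] p1 by simp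
  qed
  show "measure (zp_haar p {..n}) {\<omega> \<in> space (zp_haar p {..n}).
       int p ^ (2 * k) dvd poly (zp_poly p n (random_coeffs 0 {..n} \<omega>) m (2 * k)) (int a)} \<le>
       real p * (1 / real p) ^ (2 * k)" if s: "(m, a) \<in> labels p k" for k m a
  proof (cases "m = 0")
    case True
    then show ?thesis using p1 by (intro prob_label[OF p _ _ s, of _ _ _ 0]) auto
  next
    case False
    then have "\<not> p dvd a" using s by (auto simp: labels_def)
    then have "\<not> p dvd a ^ n" using p prime_dvd_power by blast
    then show ?thesis by (intro prob_label[OF p _ _ s, of _ _ _ n]) (auto simp flip: of_nat_power)
  qed
qed simp

text \<open>For m = 0 the constant coefficient again supplies the randomness, which is why n > 0.
  The leading coefficient is fixed, but for m > 0 the value is a unit and the event is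
  empty.\<close>

lemma summable_exceptional_monic:
  assumes p: "prime p" and e: "e \<le> 1" and n: "n > 0"
  shows "summable (\<lambda>k. measure (zp_haar p {..<n})
      {\<omega> \<in> space (zp_haar p {..<n}). exceptional p n (random_coeffs e {..<n} \<omega>) k})"
proof (rule summable_exceptional[OF p])
  have p1: "p > 1" using p prime_gt_1_nat by simp
  have one: "random_coeffs e {..<n} \<omega> n = zp_one" for \<omega> by (auto simp: random_coeffs_def)
  show "measure (zp_haar p {..<n}) {\<omega> \<in> space (zp_haar p {..<n}).
     int p ^ k dvd zp_res p k (random_coeffs e {..<n} \<omega> n)} \<le> real p * (1 / real p) ^ k" for k
  proof (cases "k = 0")
    case True
    then show ?thesis using prob_le_at_0[of p] p1 by auto
  next
    case False
    then have "1 < int p ^ k" using p1 by (simp add: one_less_power)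
    then have "\<not> int p ^ k dvd zp_res p k (random_coeffs e {..<n} \<omega> n)" for \<omega>
      using False by (simp add: one zp_res_one)
    then show ?thesis by simp
  qed
  show "measure (zp_haar p {..<n}) {\<omega> \<in> space (zp_haar p {..<n}).
       int p ^ (2 * k) dvd poly (zp_poly p n (random_coeffs e {..<n} \<omega>) m (2 * k)) (int a)} \<le>
       real p * (1 / real p) ^ (2 * k)" if s: "(m, a) \<in> labels p k" for k m a
  proof (cases "m = 0")
    case True
    then show ?thesis using p1 n by (intro prob_label[OF p e _ s, of _ _ 0]) auto
  next
    case False
    have k: "k > 0" using s by (auto simp: labels_def)
    have nd: "\<not> p dvd a" using s False by (auto simp: labels_def)
    have "\<not> int p dvd poly (zp_poly p n (random_coeffs e {..<n} \<omega>) m (2 * k)) (int a)" for \<omega>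
      unfolding zp_poly_def
      by (rule monic_not_dvd[OF p _ _ nd])
         (use k False in \<open>auto simp: one zp_res_one intro!: dvd_mult dvd_power\<close>)
    then have "\<not> int p ^ (2 * k) dvd poly (zp_poly p n (random_coeffs e {..<n} \<omega>) m (2 * k)) (int a)" for \<omega>
      using k by (meson dvd_power dvd_trans mult_pos_pos zero_less_numeral)
    then show ?thesis by simp
  qed
qed simp

section \<open>The three models and their generating functions\<close>

lemma num_roots_cong:
  assumes "\<And>i. i \<le> n \<Longrightarrow> c i = c' i"
  shows "num_roots p n c = num_roots p n c'"
proof -
  have "qp_is_root p n c x \<longleftrightarrow> qp_is_root p n c' x" for x
    using assms by (simp add: qp_is_root_def)
  then show ?thesis by (simp add: num_roots_def)
qed

lemma alpha_eq:
  "alpha p n d = (\<integral>\<omega>. real (num_roots p n (random_coeffs 0 {..<n} \<omega>) choose d) \<partial>zp_haar p {..<n})"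
  unfolding alpha_def
  by (intro Bochner_Integration.integral_cong refl arg_cong[where f = "\<lambda>x. real (x choose d)"] num_roots_cong)
     (auto simp: random_coeffs_def fun_eq_iff)

lemma beta_eq:
  "beta p n d = (\<integral>\<omega>. real (num_roots p n (random_coeffs 1 {..<n} \<omega>) choose d) \<partial>zp_haar p {..<n})"
  unfolding beta_def
  by (intro Bochner_Integration.integral_cong refl arg_cong[where f = "\<lambda>x. real (x choose d)"] num_roots_cong)
     (auto simp: random_coeffs_def fun_eq_iff)

lemma rho_eq:
  "rho p n d = (\<integral>\<omega>. real (num_roots p n (random_coeffs 0 {..n} \<omega>) choose d) \<partial>zp_haar p {..n})"
  unfolding rho_def
  by (intro Bochner_Integration.integral_cong refl arg_cong[where f = "\<lambda>x. real (x choose d)"] num_roots_cong)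
     (auto simp: random_coeffs_def fun_eq_iff)

lemma expectation_monic_degree_indep:
  assumes p: "prime p" and e: "e \<le> 1" and n: "2 * d \<le> n" "2 * d \<le> n'"
  shows "(\<integral>\<omega>. real (num_roots p n (random_coeffs e {..<n} \<omega>) choose d) \<partial>zp_haar p {..<n}) =
    (\<integral>\<omega>. real (num_roots p n' (random_coeffs e {..<n'} \<omega>) choose d) \<partial>zp_haar p {..<n'})"
\<comment> \<open>For d = 0 the degree may be 0, where no coefficient is random; both expectations
  are then 1.\<close>
proof (cases "d = 0")
  case True
  then show ?thesis
    using prob_space.prob_space[OF prob_space_zp_haar, of p "{..<n}"]
      prob_space.prob_space[OF prob_space_zp_haar, of p "{..<n'}"] by simp
next
  case False
  then have n0: "n > 0" "n' > 0" using n by auto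
  have "(\<Sum>S\<in>{S. S \<subseteq> labels p k \<and> card S = d}. ennreal (hensel_density p k e {..<n} n S)) =
      (\<Sum>S\<in>{S. S \<subseteq> labels p k \<and> card S = d}. ennreal (hensel_density p k e {..<n'} n' S))" for k
    by (intro sum.cong refl arg_cong[where f = ennreal] hensel_density_monic_degree_indep[OF p _ e])
       (use n in auto)
  then show ?thesis
    by (simp add: expectation_num_roots_choose[OF p _ summable_exceptional_monic[OF p e n0(1)]]
        expectation_num_roots_choose[OF p _ summable_exceptional_monic[OF p e n0(2)]])
qed

lemma rho_degree_indep:
  assumes p: "prime p" and n: "2 * d \<le> Suc n" "2 * d \<le> Suc n'"
  shows "rho p n d = rho p n' d"
proof -
  have "(\<Sum>S\<in>{S. S \<subseteq> labels p k \<and> card S = d}. ennreal (hensel_density p k 0 {..n} n S)) =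
      (\<Sum>S\<in>{S. S \<subseteq> labels p k \<and> card S = d}. ennreal (hensel_density p k 0 {..n'} n' S))" for k
    by (intro sum.cong refl arg_cong[where f = ennreal] hensel_density_degree_indep[OF p])
       (use n in auto)
  then show ?thesis
    by (simp add: rho_eq expectation_num_roots_choose[OF p _ summable_exceptional_general[OF p]])
qed

text \<open>Multiplication by 1 - t takes differences, which vanish beyond N; evaluation at 1 sums
  them, and the sum telescopes to a N.\<close>

lemma eventually_constant_fps:
  fixes a :: "nat \<Rightarrow> real"
  assumes "\<And>n. N \<le> n \<Longrightarrow> a n = a N"
  shows "\<exists>q :: real poly. degree q \<le> N \<and> fps_of_poly q = (1 - fps_X) * Abs_fps a \<and>
    (\<forall>n. N \<le> n \<longrightarrow> a n = poly q 1)"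
proof (intro exI conjI allI impI)
  define b where "b i = a i - (if i = 0 then 0 else a (i - 1))" for i
  let ?q = "coeff_poly N b"
  show "degree ?q \<le> N" by (rule degree_le) (simp add: coeff_coeff_poly)
  show "fps_of_poly ?q = (1 - fps_X) * Abs_fps a"
  proof (rule fps_ext)
    fix n
    have "a n = a (n - 1)" if "N < n" using that assms[of n] assms[of "n - 1"] by simp
    then show "fps_nth (fps_of_poly ?q) n = fps_nth ((1 - fps_X) * Abs_fps a) n"
      by (auto simp: coeff_coeff_poly b_def left_diff_distrib fps_X_mult_nth)
  qed
  have "(\<Sum>i\<le>m. b i) = a m" for m by (induction m) (simp_all add: b_def)
  then have "poly ?q 1 = a N" by (simp add: poly_coeff_poly)
  then show "a n = poly ?q 1" if "N \<le> n" for n using assms[OF that] by simp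
qed

theorem theorem1p1:
  fixes p d :: nat
  assumes "prime p"
  shows "(\<exists>q :: real poly. degree q \<le> 2 * d \<and>
            fps_of_poly q = (1 - fps_X) * Abs_fps (\<lambda>n. alpha p n d) \<and>
            (\<forall>n. 2 * d \<le> n \<longrightarrow> alpha p n d = poly q 1))
       \<and> (\<exists>q :: real poly. degree q \<le> 2 * d \<and>
            fps_of_poly q = (1 - fps_X) * Abs_fps (\<lambda>n. beta p n d) \<and>
            (\<forall>n. 2 * d \<le> n \<longrightarrow> beta p n d = poly q 1))
       \<and> (\<exists>q :: real poly. degree q \<le> 2 * d \<and>
            fps_of_poly q = (1 - fps_X) * (1 - fps_const (real p) * fps_X) *
                            Abs_fps (\<lambda>n. (\<Sum>i\<le>n. real p ^ i) * rho p n d) \<and>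
            (\<forall>n. 2 * d \<le> n + 1 \<longrightarrow> rho p n d = poly q 1))"
proof (intro conjI)
  show "\<exists>q :: real poly. degree q \<le> 2 * d \<and>
            fps_of_poly q = (1 - fps_X) * Abs_fps (\<lambda>n. alpha p n d) \<and>
            (\<forall>n. 2 * d \<le> n \<longrightarrow> alpha p n d = poly q 1)"
  proof (rule eventually_constant_fps)
    show "alpha p n d = alpha p (2 * d) d" if "2 * d \<le> n" for n
      unfolding alpha_eq by (rule expectation_monic_degree_indep[OF assms]) (use that in auto)
  qed
  show "\<exists>q :: real poly. degree q \<le> 2 * d \<and>
            fps_of_poly q = (1 - fps_X) * Abs_fps (\<lambda>n. beta p n d) \<and>
            (\<forall>n. 2 * d \<le> n \<longrightarrow> beta p n d = poly q 1)"
  proof (rule eventually_constant_fps)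
    show "beta p n d = beta p (2 * d) d" if "2 * d \<le> n" for n
      unfolding beta_eq by (rule expectation_monic_degree_indep[OF assms]) (use that in auto)
  qed
  define s where "s n = (\<Sum>i\<le>n. real p ^ i) * rho p n d" for n
  define g where "g n = s n - (if n = 0 then 0 else real p * s (n - 1))" for n
  \<comment> \<open>The factor 1 - p t reduces the weights 1 + p + ... + p^n to 1. At n = 2d this
    compares \<open>rho\<close> in degrees 2d and 2d - 1, so the longer range of
    \<open>rho_degree_indep\<close> is what keeps the degree bound at 2d.\<close>
  have g: "g n = rho p n d" if n: "2 * d \<le> n" for n
  proof (cases n)
    case (Suc m)
    have "rho p m d = rho p n d" by (rule rho_degree_indep[OF assms]) (use n Suc in auto)
    moreover have "(\<Sum>i\<le>n. real p ^ i) = 1 + real p * (\<Sum>i\<le>m. real p ^ i)"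
      unfolding Suc sum.atMost_Suc_shift by (simp add: sum_distrib_left)
    ultimately show ?thesis using Suc by (simp add: g_def s_def algebra_simps)
  qed (simp add: g_def s_def)
  have "(1 - fps_const (real p) * fps_X) * Abs_fps s = Abs_fps g"
    by (rule fps_ext) (simp add: g_def left_diff_distrib mult.assoc fps_X_mult_nth)
  moreover have "\<exists>q :: real poly. degree q \<le> 2 * d \<and> fps_of_poly q = (1 - fps_X) * Abs_fps g \<and>
    (\<forall>n. 2 * d \<le> n \<longrightarrow> g n = poly q 1)"
  proof (rule eventually_constant_fps)
    fix n assume "2 * d \<le> n"
    then show "g n = g (2 * d)" using rho_degree_indep[OF assms, of d n "2 * d"] by (simp add: g)
  qed
  ultimately obtain q :: "real poly" where q: "degree q \<le> 2 * d"
      "fps_of_poly q = (1 - fps_X) * ((1 - fps_const (real p) * fps_X) * Abs_fps s)"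
      "g (2 * d) = poly q 1"
    by auto
  \<comment> \<open>The value q(1) is \<open>rho\<close> in degree 2d; a further use of degree
    independence reaches n = 2d - 1.\<close>
  have "rho p n d = poly q 1" if "2 * d \<le> n + 1" for n
    using rho_degree_indep[OF assms, of d n "2 * d"] that q(3) g[of "2 * d"] by simp
  then show "\<exists>q :: real poly. degree q \<le> 2 * d \<and>
            fps_of_poly q = (1 - fps_X) * (1 - fps_const (real p) * fps_X) *
                            Abs_fps (\<lambda>n. (\<Sum>i\<le>n. real p ^ i) * rho p n d) \<and>
            (\<forall>n. 2 * d \<le> n + 1 \<longrightarrow> rho p n d = poly q 1)"
    using q(1,2) by (intro exI[of _ q]) (simp add: s_def[abs_def] mult.assoc)
qed

end
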